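(* Consider an $M$-step Adams--Bashforth scheme with $M\ge2$ and order $p=M$. Assume that $$\rho_{\rm AB}:=\max\{|\lambda|:\lambda\in\mathbb{C},\ p_{\rm AB}(\lambda)=0\}<1,\qquad p_{\rm AB}(z)=\beta_1z^{M-1}+\beta_2z^{M-2}+\cdots+\beta_M .$$ Let $\hat R>0$ be independent of $h$, and for each $h$ let $u_h\in\mathcal{A}_{\hat R}$ be a zero-residual solution of the non-auxiliary loss, i.e. $J_h(u_h)=0$. Suppose that the boundary layer error $E_0=E_0(h)=\sum_{j=0}^{M-2}|u_h(\mathbf{x}_j)-f(\mathbf{x}_j)|$ remains bounded as $h\to0^+$. Then, for every fixed $\delta\in(0,T)$ and $\theta\in(\rho_{\rm AB},1)$, there exists $\hat h>0$ such that, for all $0<h<\hat h$, $$\int_\delta^T|u_h(\mathbf{x}(t))-f(\mathbf{x}(t))|\,dt\le C_{M,\theta}\,(C+\hat R)\,h^p,$$ where the constants $C_{M,\theta}$ and $C$ are independent of $h$ and $\hat R$.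
   Context: Data. $\mathbf{x}:[0,T]\to\mathbb{R}^d$ is a sufficiently smooth solution of $\dot{\mathbf{x}}=\mathbf{f}(\mathbf{x})$, $\mathbf{x}(0)=\mathbf{x}_{\rm init}$ (smooth enough for the order-$p$ truncation estimate; $\mathbf{x}\in C^{p+1}([0,T])^d$). For $N\in\mathbb{N}$, $N\ge M$, put $h=T/N$ (so $h$ ranges over the values $T/N$), $t_n=nh$, $\mathbf{x}_n=\mathbf{x}(t_n)$, $0\le n\le N$. $f$ denotes one fixed scalar component of $\mathbf{f}$ and $x_n$ the corresponding scalar component of $\mathbf{x}_n$. $\Omega_{\mathcal{T}}\subset\mathbb{R}^d$ is a fixed neighborhood of the trajectory $\mathcal{T}=\{\mathbf{x}(t):0\le t\le T\}$, and the admissible class $\mathcal{A}$ is a subset of $C(\Omega_{\mathcal{T}})$. Scheme. The $M$-step Adams--Bashforth (A-B) scheme is $x_n-x_{n-1}=h\sum_{m=1}^M\beta_mf_{n-m}$ (so $\alpha_0=1,\alpha_1=-1$, other $\alpha_m=0$, $\beta_0=0$) with $\beta_m=\frac{(-1)^{m-1}}{(m-1)!(M-m)!}\int_0^1\prod_{i=0,i\ne m-1}^{M-1}(u+i)\,du$, $1\le m\le M$. Non-auxiliary loss. For $u\in\mathcal{A}$, $$J_h(u)=\frac1{N-M+1}\sum_{n=M}^N\Big|\sum_{m=1}^M\beta_mu(\mathbf{x}_{n-m})-h^{-1}\sum_{m=0}^M\alpha_mx_{n-m}\Big|^2 .$$ Trace regularity class. For $\hat R>0$, $\mathcal{A}_{\hat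 R}$ is the set of $u\in\mathcal{A}$ such that $g(t)=u(\mathbf{x}(t))-f(\mathbf{x}(t))$ belongs to the Sobolev space $W^{p,1}(0,T)$ with seminorm $|g|_{W^{p,1}(0,T)}=\|g^{(p)}\|_{L^1(0,T)}\le\hat R$. *)

theory Defs
  imports "HOL-Analysis.Analysis" "HOL-Computational_Algebra.Polynomial"
begin

section \<open>Smoothness and Sobolev classes on an interval\<close>

text \<open>One-sided derivatives are used at the end points of \<open>[a, b]\<close>.\<close>

definition Ck_on_interval :: "nat \<Rightarrow> real \<Rightarrow> real \<Rightarrow> (real \<Rightarrow> 'a::real_normed_vector) \<Rightarrow> bool" where
  "Ck_on_interval k a b x \<longleftrightarrow>
     (\<exists>D :: nat \<Rightarrow> real \<Rightarrow> 'a.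
        (\<forall>t\<in>{a..b}. D 0 t = x t) \<and>
        (\<forall>j<k. \<forall>t\<in>{a..b}. (D j has_vector_derivative D (Suc j) t) (at t within {a..b})) \<and>
        continuous_on {a..b} (D k))"

definition test_function :: "real \<Rightarrow> real \<Rightarrow> (real \<Rightarrow> real) \<Rightarrow> bool" where
  "test_function a b \<phi> \<longleftrightarrow>
     (\<forall>k t. ((deriv ^^ k) \<phi>) differentiable (at t)) \<and>
     (\<exists>K. compact K \<and> K \<subseteq> {a<..<b} \<and> (\<forall>t. t \<notin> K \<longrightarrow> \<phi> t = 0))"

definition has_weak_deriv :: "nat \<Rightarrow> real \<Rightarrow> real \<Rightarrow> (real \<Rightarrow> real) \<Rightarrow> (real \<Rightarrow> real) \<Rightarrow> bool" where
  "has_weak_deriv k a b g w \<longleftrightarrow>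
     set_integrable lebesgue {a<..<b} w \<and>
     (\<forall>\<phi>. test_function a b \<phi> \<longrightarrow>
        (LINT t:{a<..<b}|lebesgue. g t * (deriv ^^ k) \<phi> t)
          = (-1) ^ k * (LINT t:{a<..<b}|lebesgue. w t * \<phi> t))"

definition sobolev_W1 :: "nat \<Rightarrow> real \<Rightarrow> real \<Rightarrow> (real \<Rightarrow> real) set" where
  "sobolev_W1 p a b =
     {g. set_integrable lebesgue {a<..<b} g \<and> (\<forall>k\<le>p. \<exists>w. has_weak_deriv k a b g w)}"

text \<open>Weak derivatives are unique up to null sets, so the seminorm does not depend on the
  representative picked by the choice operator.\<close>

definition weak_deriv :: "nat \<Rightarrow> real \<Rightarrow> real \<Rightarrow> (real \<Rightarrow> real) \<Rightarrow> real \<Rightarrow> real" where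
  "weak_deriv k a b g = (SOME w. has_weak_deriv k a b g w)"

definition sobolev_W1_seminorm :: "nat \<Rightarrow> real \<Rightarrow> real \<Rightarrow> (real \<Rightarrow> real) \<Rightarrow> real" where
  "sobolev_W1_seminorm p a b g = (LINT t:{a<..<b}|lebesgue. \<bar>weak_deriv p a b g t\<bar>)"

section \<open>The Adams--Bashforth scheme\<close>

definition ab_alpha :: "nat \<Rightarrow> real" where
  "ab_alpha m = (if m = 0 then 1 else if m = 1 then -1 else 0)"

definition ab_beta :: "nat \<Rightarrow> nat \<Rightarrow> real" where
  "ab_beta M m =
     (if 1 \<le> m \<and> m \<le> M
      then (-1) ^ (m - 1) / (fact (m - 1) * fact (M - m)) *
           integral {0..1} (\<lambda>u::real. \<Prod>i\<in>{0..M - 1} - {m - 1}. (u + real i))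
      else 0)"

definition ab_poly :: "nat \<Rightarrow> complex poly" where
  "ab_poly M = (\<Sum>m=1..M. monom (complex_of_real (ab_beta M m)) (M - m))"

definition rho_ab :: "nat \<Rightarrow> real" where
  "rho_ab M = Max {cmod z | z. poly (ab_poly M) z = 0}"

section \<open>Loss, trace regularity class and boundary layer error\<close>

text \<open>The grid with \<open>N\<close> steps has step size \<open>h = T / N\<close>; the loss \<open>J\<^sub>h\<close> and the error \<open>E\<^sub>0(h)\<close>
  are indexed by \<open>N\<close> instead of \<open>h\<close>. The component is \<open>f = (\<lambda>y. F y $ i)\<close>.\<close>

definition grid :: "real \<Rightarrow> nat \<Rightarrow> nat \<Rightarrow> real" where
  "grid T N n = real n * (T / real N)"

definition ab_loss ::
  "nat \<Rightarrow> real \<Rightarrow> (real \<Rightarrow> real ^ 'd) \<Rightarrow> 'd \<Rightarrow> nat \<Rightarrow> (real ^ 'd \<Rightarrow> real) \<Rightarrow> real" where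
  "ab_loss M T x i N u =
     1 / (real N - real M + 1) *
     (\<Sum>n=M..N. \<bar>(\<Sum>m=1..M. ab_beta M m * u (x (grid T N (n - m))))
        - inverse (T / real N) * (\<Sum>m=0..M. ab_alpha m * (x (grid T N (n - m)) $ i))\<bar> ^ 2)"

definition trace_class ::
  "nat \<Rightarrow> real \<Rightarrow> (real \<Rightarrow> real ^ 'd) \<Rightarrow> (real ^ 'd \<Rightarrow> real) \<Rightarrow> (real ^ 'd \<Rightarrow> real) set
     \<Rightarrow> real \<Rightarrow> (real ^ 'd \<Rightarrow> real) set" where
  "trace_class p T x f A R =
     {u \<in> A. (\<lambda>t. u (x t) - f (x t)) \<in> sobolev_W1 p 0 T \<and>
             sobolev_W1_seminorm p 0 T (\<lambda>t. u (x t) - f (x t)) \<le> R}"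

definition boundary_error ::
  "nat \<Rightarrow> real \<Rightarrow> (real \<Rightarrow> real ^ 'd) \<Rightarrow> (real ^ 'd \<Rightarrow> real) \<Rightarrow> nat \<Rightarrow> (real ^ 'd \<Rightarrow> real) \<Rightarrow> real" where
  "boundary_error M T x f N u =
     (\<Sum>j=0..M - 2. \<bar>u (x (grid T N j)) - f (x (grid T N j))\<bar>)"

end

theory Submission
  imports Defs "HOL-Computational_Algebra.Fundamental_Theorem_Algebra"
begin

text \<open>
  Let \<open>g = u\<^sub>h \<circ> x - f \<circ> x\<close> be the error along the trajectory. The proof first controls \<open>g\<close> on the
  grid and then between the grid points.

  \<^bold>\<open>On the grid.\<close> A zero residual means that \<open>u\<^sub>h\<close> satisfies the Adams--Bashforth relation exactly,
  whereas \<open>f\<close> satisfies it up to the truncation error \<open>O(h\<^sup>M)\<close> (\<open>ab_truncation_error\<close>). Subtracting,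
  the values \<open>g(t\<^sub>n)\<close> solve the linear recurrence with characteristic polynomial \<open>p\<^sub>A\<^sub>B\<close> and an
  inhomogeneity of size \<open>O(h\<^sup>M)\<close>. Since all roots lie in the disc of radius \<open>\<rho>\<^sub>A\<^sub>B < \<theta> < 1\<close>, the
  recurrence damps the \<open>M - 1\<close> free starting values like \<open>\<theta>\<^sup>n\<close> and amplifies the inhomogeneity only by
  a constant (\<open>ab_recurrence_decay\<close>). At times \<open>t\<^sub>n\<close> beyond a fixed \<open>\<delta>\<close> one has \<open>n \<ge> \<delta>/h\<close> up to a
  constant, so \<open>\<theta>\<^sup>n\<close> is eventually smaller than any power of \<open>h\<close> and the bounded starting error no longer
  matters.

  \<^bold>\<open>Between the grid points.\<close> Extrapolating \<open>g\<close> from \<open>M\<close> consecutive grid points to a point \<open>t\<close>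
  of the next cell is exact on polynomials of degree below \<open>M\<close>. Hence the extrapolation error is a finite
  combination of point values that annihilates these polynomials, and such a functional is bounded by
  a constant multiple of \<open>h\<^sup>M\<^sup>-\<^sup>1\<close> times the \<open>L\<^sup>1\<close> norm of the \<open>M\<close>-th derivative on the cells involved
  (\<open>weak_deriv_functional_bound\<close>). Integrating over \<open>t\<close> yields one more factor \<open>h\<close>, and summing over the
  cells counts each of them at most \<open>M + 2\<close> times (\<open>integral_bound_from_grid\<close>).

  The derivative of \<open>g\<close> is only a weak one. Instead of first establishing a regular representative, the
  functional is smeared out by a mollifier to a smooth function \<open>\<psi>\<close>. As the moments of \<open>\<psi>\<close> of order below
  \<open>M\<close> vanish, \<open>M\<close>-fold integration of \<open>\<psi>\<close> leads to a function \<open>\<phi>\<close> that still has compact support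
  (\<open>vanishing_moments_imp_iterated_derivative\<close>), that is, to a test function with \<open>\<phi>\<^sup>(\<^sup>M\<^sup>) = \<psi>\<close>, to which
  the definition of the weak derivative applies directly.
\<close>

section \<open>Smooth functions and mollifiers\<close>

text \<open>Unlike a condition on the iterates of \<open>deriv\<close>, this recursion passes from \<open>f\<close> to some derivative \<open>f'\<close>.
  Closure under sums, products and affine substitutions then follows by induction on the order for
  arbitrary functions, with no formula for higher derivatives of a product.\<close>

primrec times_differentiable :: "nat \<Rightarrow> (real \<Rightarrow> real) \<Rightarrow> bool" where
  "times_differentiable 0 f \<longleftrightarrow> True"
| "times_differentiable (Suc n) f \<longleftrightarrow> (\<exists>f'. (\<forall>t. (f has_real_derivative f' t) (at t)) \<and> times_differentiable n f')"

definition smooth :: "(real \<Rightarrow> real) \<Rightarrow> bool" where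
  "smooth f \<longleftrightarrow> (\<forall>n. times_differentiable n f)"

lemma times_differentiable_SucI:
  "(\<And>t. (f has_real_derivative f' t) (at t)) \<Longrightarrow> times_differentiable n f' \<Longrightarrow> times_differentiable (Suc n) f"
  by auto

lemma times_differentiable_antimono: "times_differentiable (Suc n) f \<Longrightarrow> times_differentiable n f"
proof (induction n arbitrary: f)
  case (Suc n)
  then obtain f' where f': "\<forall>t. (f has_real_derivative f' t) (at t)" "times_differentiable (Suc n) f'"
    by (auto simp del: times_differentiable.simps(2) simp: times_differentiable.simps(2)[of "Suc n"])
  with Suc.IH[OF f'(2)] show ?case by auto
qed simp

lemma times_differentiable_const: "times_differentiable n (\<lambda>_. c)"
proof (induction n arbitrary: c)
  case (Suc n)
  show ?case by (rule times_differentiable_SucI[OF _ Suc[of 0]]) simp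
qed simp

lemma times_differentiable_add: "times_differentiable n f \<Longrightarrow> times_differentiable n g \<Longrightarrow> times_differentiable n (\<lambda>t. f t + g t)"
proof (induction n arbitrary: f g)
  case (Suc n)
  then obtain f' g' where
    d: "\<forall>t. (f has_real_derivative f' t) (at t)" "times_differentiable n f'"
       "\<forall>t. (g has_real_derivative g' t) (at t)" "times_differentiable n g'"
    by auto
  have "((\<lambda>t. f t + g t) has_real_derivative f' t + g' t) (at t)" for t
    using d by (auto intro!: derivative_eq_intros)
  from times_differentiable_SucI[OF this Suc.IH[OF d(2,4)]] show ?case .
qed simp

lemma times_differentiable_mult: "times_differentiable n f \<Longrightarrow> times_differentiable n g \<Longrightarrow> times_differentiable n (\<lambda>t. f t * g t)"
proof (induction n arbitrary: f g)
  case (Suc n)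
  then obtain f' g' where
    d: "\<forall>t. (f has_real_derivative f' t) (at t)" "times_differentiable n f'"
       "\<forall>t. (g has_real_derivative g' t) (at t)" "times_differentiable n g'"
    by auto
  have "((\<lambda>t. f t * g t) has_real_derivative f' t * g t + f t * g' t) (at t)" for t
    using d by (auto intro!: derivative_eq_intros)
  moreover have "times_differentiable n (\<lambda>t. f' t * g t + f t * g' t)"
    using Suc times_differentiable_antimono d by (intro times_differentiable_add Suc.IH) blast+
  ultimately show ?case by (rule times_differentiable_SucI)
qed simp

lemma times_differentiable_affine: "times_differentiable n f \<Longrightarrow> times_differentiable n (\<lambda>t. f (c * t + d))"
proof (induction n arbitrary: f)
  case (Suc n)
  then obtain f' where
    d: "\<forall>t. (f has_real_derivative f' t) (at t)" "times_differentiable n f'" by auto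
  have "((\<lambda>t. f (c * t + d)) has_real_derivative c * f' (c * t + d)) (at t)" for t
  proof -
    have "((\<lambda>t. c * t + d) has_real_derivative c) (at t)"
      by (auto intro!: derivative_eq_intros)
    from DERIV_chain2[OF d(1)[rule_format] this] show ?thesis by (simp add: mult.commute)
  qed
  moreover have "times_differentiable n (\<lambda>t. c * f' (c * t + d))"
    using Suc.IH[OF d(2)] by (intro times_differentiable_mult times_differentiable_const)
  ultimately show ?case by (rule times_differentiable_SucI)
qed simp

lemma times_differentiable_deriv_funpow: "times_differentiable (Suc k) f \<Longrightarrow> ((deriv ^^ k) f) differentiable (at t)"
proof (induction k arbitrary: f)
  case 0
  then show ?case by (auto simp: real_differentiable_def)
next
  case (Suc k)
  then obtain f' where f': "\<forall>t. (f has_real_derivative f' t) (at t)" "times_differentiable (Suc k) f'"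
    by (auto simp del: times_differentiable.simps(2) simp: times_differentiable.simps(2)[of "Suc k"])
  have "deriv f = f'" using f'(1) by (auto intro!: ext DERIV_imp_deriv)
  with Suc.IH[OF f'(2)] show ?case by (simp add: funpow_Suc_right del: funpow.simps)
qed

lemma smooth_differentiable: "smooth f \<Longrightarrow> ((deriv ^^ k) f) differentiable (at t)"
  by (simp add: smooth_def times_differentiable_deriv_funpow del: times_differentiable.simps)

lemma smooth_continuous_on: "smooth f \<Longrightarrow> continuous_on S f"
  using smooth_differentiable[of f 0]
  by (auto intro!: continuous_at_imp_continuous_on differentiable_imp_continuous_within)

lemma smooth_cmult_affine: "smooth f \<Longrightarrow> smooth (\<lambda>t. c * f (a * t + b))"
  by (simp add: smooth_def times_differentiable_mult times_differentiable_const times_differentiable_affine)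

lemma smooth_mult: "smooth f \<Longrightarrow> smooth g \<Longrightarrow> smooth (\<lambda>t. f t * g t)"
  by (simp add: smooth_def times_differentiable_mult)

lemma smooth_sum: "finite I \<Longrightarrow> (\<And>i. i \<in> I \<Longrightarrow> smooth (f i)) \<Longrightarrow> smooth (\<lambda>t. \<Sum>i\<in>I. f i t)"
  by (induction I rule: finite_induct) (auto simp: smooth_def times_differentiable_const times_differentiable_add)

lemma smooth_antiderivative:
  assumes "\<And>t. (f has_real_derivative f' t) (at t)" "smooth f'"
  shows "smooth f"
  unfolding smooth_def
proof
  fix n
  have "times_differentiable n f'" using assms(2) by (simp add: smooth_def)
  from times_differentiable_SucI[OF assms(1) this] show "times_differentiable n f" by (rule times_differentiable_antimono)
qed

text \<open>The functions \<open>P(1/x) e\<^sup>-\<^sup>1\<^sup>/\<^sup>x\<close>, continued by \<open>0\<close> to \<open>x \<le> 0\<close>. The polynomial factor is included because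
  the family is then closed under differentiation, which gives smoothness of all its members at once.\<close>

definition flat_exp :: "real poly \<Rightarrow> real \<Rightarrow> real" where
  "flat_exp P x = (if x > 0 then poly P (1 / x) * exp (- (1 / x)) else 0)"

lemma poly_over_exp_tendsto_0: "((\<lambda>y. poly P y * exp (- y)) \<longlongrightarrow> (0::real)) at_top"
proof -
  have "((\<lambda>y::real. \<Sum>i\<le>degree P. coeff P i * (y ^ i / exp y)) \<longlongrightarrow> (\<Sum>i\<le>degree P. coeff P i * 0)) at_top"
    by (intro tendsto_intros tendsto_power_div_exp_0)
  moreover have "(\<Sum>i\<le>degree P. coeff P i * (y ^ i / exp y)) = poly P y * exp (- y)" for y
    by (simp add: poly_altdef sum_distrib_right exp_minus divide_inverse mult.assoc)
  ultimately show ?thesis by simp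
qed

text \<open>Away from the origin this is the chain rule. At the origin the difference quotient from the right is
  \<open>y P(y) e\<^sup>-\<^sup>y\<close> with \<open>y = 1/x \<rightarrow> \<infinity>\<close>, where the exponential beats every polynomial.\<close>

lemma flat_exp_deriv:
  "(flat_exp P has_real_derivative flat_exp ([:0, 0, 1:] * (P - pderiv P)) x) (at x)"
proof -
  consider "x > 0" | "x < 0" | "x = 0" by linarith
  then show ?thesis
  proof cases
    case 1
    have "((\<lambda>x. poly P (1 / x) * exp (- (1 / x))) has_real_derivative
        flat_exp ([:0, 0, 1:] * (P - pderiv P)) x) (at x)"
      using 1 by (auto intro!: derivative_eq_intros poly_DERIV[THEN DERIV_chain2]
          simp: flat_exp_def field_simps power2_eq_square)
    then show ?thesis
      by (rule has_field_derivative_transform_within_open[where S = "{0<..}"])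
         (use 1 in \<open>auto simp: flat_exp_def\<close>)
  next
    case 2
    have "((\<lambda>x. 0) has_real_derivative flat_exp ([:0, 0, 1:] * (P - pderiv P)) x) (at x)"
      using 2 by (simp add: flat_exp_def)
    then show ?thesis
      by (rule has_field_derivative_transform_within_open[where S = "{..<0}"])
         (use 2 in \<open>auto simp: flat_exp_def\<close>)
  next
    case 3
    have "((\<lambda>y. (flat_exp P y - flat_exp P 0) / (y - 0)) \<longlongrightarrow> 0) (at_right 0)"
    proof -
      have "((\<lambda>x. poly ([:0, 1:] * P) (inverse x) * exp (- (inverse x))) \<longlongrightarrow> 0) (at_right (0::real))"
        using filterlim_compose[OF poly_over_exp_tendsto_0[of "[:0,1:] * P"] filterlim_inverse_at_top_right] .
      moreover have "\<forall>\<^sub>F x in at_right (0::real). poly ([:0, 1:] * P) (inverse x) * exp (- (inverse x))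
          = (flat_exp P x - flat_exp P 0) / (x - 0)"
        using eventually_at_right_less[of "0::real"]
        by eventually_elim (auto simp: flat_exp_def field_simps)
      ultimately show ?thesis by (rule Lim_transform_eventually)
    qed
    moreover have "((\<lambda>y. (flat_exp P y - flat_exp P 0) / (y - 0)) \<longlongrightarrow> 0) (at_left 0)"
      by (rule tendsto_eventually, rule eventually_at_leftI[of "-1"]) (auto simp: flat_exp_def)
    ultimately have "((\<lambda>y. (flat_exp P y - flat_exp P 0) / (y - 0)) \<longlongrightarrow> 0) (at 0)"
      by (simp add: filterlim_split_at_real)
    then show ?thesis using 3 by (simp add: has_field_derivative_iff flat_exp_def)
  qed
qed

lemma smooth_flat_exp: "smooth (flat_exp P)"
proof -
  have "times_differentiable n (flat_exp P)" for n
  proof (induction n arbitrary: P)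
    case (Suc n)
    from times_differentiable_SucI[OF flat_exp_deriv Suc] show ?case .
  qed simp
  then show ?thesis by (simp add: smooth_def)
qed

text \<open>The product of two flat exponentials, one vanishing left of \<open>-e\<close> and one right of \<open>e\<close>, divided by its
  integral.\<close>

lemma mollifier_exists:
  fixes e :: real
  assumes "e > 0"
  obtains \<eta> where "smooth \<eta>" "\<And>t. \<eta> t \<ge> 0" "\<And>t. \<bar>t\<bar> \<ge> e \<Longrightarrow> \<eta> t = 0" "integral {-e..e} \<eta> = 1"
proof -
  define \<zeta> where "\<zeta> t = flat_exp 1 (1 * t + e) * flat_exp 1 (- 1 * t + e)" for t
  have sm: "smooth \<zeta>"
    unfolding \<zeta>_def
    using smooth_mult[OF smooth_cmult_affine[OF smooth_flat_exp, of 1 1 1 e]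
        smooth_cmult_affine[OF smooth_flat_exp, of 1 1 "-1" e]] by simp
  have nn: "\<zeta> t \<ge> 0" for t by (auto simp: \<zeta>_def flat_exp_def)
  have supp: "\<zeta> t = 0" if "\<bar>t\<bar> \<ge> e" for t using that by (auto simp: \<zeta>_def flat_exp_def)
  have cont: "continuous_on {-e..e} \<zeta>" by (rule smooth_continuous_on[OF sm])
  have "integral {-e..e} \<zeta> \<noteq> 0"
  proof
    assume "integral {-e..e} \<zeta> = 0"
    then have "(\<zeta> has_integral 0) {-e..e}"
      using cont integrable_continuous_real integrable_integral by metis
    then have "\<zeta> 0 = 0"
      using has_integral_0_cbox_imp_0[of "-e" e \<zeta> 0] cont nn assms by auto
    then show False using assms by (simp add: \<zeta>_def flat_exp_def)
  qed
  moreover have "integral {-e..e} \<zeta> \<ge> 0"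
    by (rule integral_nonneg) (auto intro: integrable_continuous_real cont nn)
  ultimately have pos: "integral {-e..e} \<zeta> > 0" by simp
  show ?thesis
  proof
    show "smooth (\<lambda>t. 1 / integral {-e..e} \<zeta> * \<zeta> t)"
      using smooth_cmult_affine[OF sm, of "1 / integral {-e..e} \<zeta>" 1 0] by simp
    show "integral {-e..e} (\<lambda>t. 1 / integral {-e..e} \<zeta> * \<zeta> t) = 1"
      using pos by simp
  qed (use nn supp pos in auto)
qed

section \<open>Point functionals and weak derivatives\<close>

text \<open>The antiderivative that vanishes to the left of the support is, to its right, constantly equal to the
  total integral, which is \<open>0\<close>.\<close>

lemma compactly_supported_antiderivative:
  fixes a b :: real
  assumes "a < b" and sm: "smooth \<psi>" and supp: "\<And>t. t \<notin> {a<..<b} \<Longrightarrow> \<psi> t = 0"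
    and zero: "integral {a..b} \<psi> = 0"
  obtains \<Phi> where "\<And>t. (\<Phi> has_real_derivative \<psi> t) (at t)"
    "\<And>t. t \<notin> {a<..<b} \<Longrightarrow> \<Phi> t = 0"
    "\<And>t. \<bar>\<Phi> t\<bar> \<le> integral {a..b} (\<lambda>t. \<bar>\<psi> t\<bar>)"
proof -
  define \<Phi> where "\<Phi> t = integral {a..t} \<psi>" for t
  have cont: "continuous_on S \<psi>" for S by (rule smooth_continuous_on[OF sm])
  have int: "\<psi> integrable_on {u..v}" "(\<lambda>t. \<bar>\<psi> t\<bar>) integrable_on {u..v}" for u v
    by (intro integrable_continuous_real continuous_intros cont)+
  have vanish: "integral {u..v} \<psi> = 0" if "{u..v} \<inter> {a<..<b} = {}" for u v
  proof -
    have "\<psi> x = 0" if "x \<in> {u..v}" for x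
      using supp \<open>{u..v} \<inter> {a<..<b} = {}\<close> that by blast
    then have "integral {u..v} \<psi> = integral {u..v} (\<lambda>_. 0)" by (rule integral_cong)
    then show ?thesis by simp
  qed
  have low: "\<Phi> t = 0" if "t \<le> a" for t unfolding \<Phi>_def using that by (intro vanish) auto
  have high: "\<Phi> t = 0" if "t \<ge> b" for t
  proof -
    have "integral {b..t} \<psi> = 0" by (rule vanish) auto
    then show ?thesis
      using Henstock_Kurzweil_Integration.integral_combine[OF _ that int(1), of a] \<open>a < b\<close> zero by (simp add: \<Phi>_def)
  qed
  have start: "integral {c..u} \<psi> = \<Phi> u" if "c \<le> a" for c u
  proof (cases "u \<ge> a")
    case True
    have "integral {c..a} \<psi> = 0" by (rule vanish) auto
    then show ?thesis
      using Henstock_Kurzweil_Integration.integral_combine[OF that True int(1)] by (simp add: \<Phi>_def)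
  next
    case False
    have "integral {c..u} \<psi> = 0" by (rule vanish) (use False in auto)
    then show ?thesis using low False by simp
  qed
  show thesis
  proof
    fix t
    define c where "c = min a t - 1"
    have "((\<lambda>u. integral {c..u} \<psi>) has_real_derivative \<psi> t) (at t within {c..t + 1})"
      by (rule integral_has_real_derivative) (auto intro: cont simp: c_def)
    moreover have "at t within {c..t + 1} = at t"
      by (rule at_within_interior) (auto simp: c_def)
    ultimately show "(\<Phi> has_real_derivative \<psi> t) (at t)"
      using start[of c] by (simp add: c_def)
    show "t \<notin> {a<..<b} \<Longrightarrow> \<Phi> t = 0" using low[of t] high[of t] by force
    have "\<bar>\<Phi> t\<bar> \<le> integral {a..t} (\<lambda>t. \<bar>\<psi> t\<bar>)" if "t \<le> b"
      unfolding \<Phi>_def using integral_norm_bound_integral[OF int(1) int(2)] by auto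
    also have "integral {a..t} (\<lambda>t. \<bar>\<psi> t\<bar>) \<le> integral {a..b} (\<lambda>t. \<bar>\<psi> t\<bar>)" if "t \<le> b"
      using that by (intro integral_subset_le int) auto
    finally have "t \<le> b \<Longrightarrow> \<bar>\<Phi> t\<bar> \<le> integral {a..b} (\<lambda>t. \<bar>\<psi> t\<bar>)" by blast
    moreover have "0 \<le> integral {a..b} (\<lambda>t. \<bar>\<psi> t\<bar>)" by (intro integral_nonneg int) auto
    ultimately show "\<bar>\<Phi> t\<bar> \<le> integral {a..b} (\<lambda>t. \<bar>\<psi> t\<bar>)" using high[of t] by force
  qed
qed

text \<open>Each antiderivative uses up one moment: by parts, \<open>\<integral>\<Phi> t\<^sup>j = - \<integral>\<psi> t\<^sup>j\<^sup>+\<^sup>1 / (j+1)\<close>, so the moments of \<open>\<Phi>\<close>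
  vanish up to one order less and the construction can be repeated. The first antiderivative is bounded by
  the \<open>L\<^sup>1\<close> norm of \<open>\<psi>\<close>, and each further one costs a factor \<open>b - a\<close>.\<close>

lemma vanishing_moments_imp_iterated_derivative:
  fixes a b :: real
  assumes "a < b" and "smooth \<psi>" and "\<And>t. t \<notin> {a<..<b} \<Longrightarrow> \<psi> t = 0"
    and "\<And>j. j \<le> p \<Longrightarrow> integral {a..b} (\<lambda>t. \<psi> t * t ^ j) = 0"
    and "integral {a..b} (\<lambda>t. \<bar>\<psi> t\<bar>) \<le> S"
  shows "\<exists>\<phi>. smooth \<phi> \<and> (\<forall>t. t \<notin> {a<..<b} \<longrightarrow> \<phi> t = 0) \<and> (deriv ^^ Suc p) \<phi> = \<psi> \<and>
    (\<forall>t. \<bar>\<phi> t\<bar> \<le> (b - a) ^ p * S)"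
  using assms(2-5)
proof (induction p arbitrary: \<psi> S)
  case 0
  obtain \<Phi> where \<Phi>: "\<And>t. (\<Phi> has_real_derivative \<psi> t) (at t)"
    "\<And>t. t \<notin> {a<..<b} \<Longrightarrow> \<Phi> t = 0"
    "\<And>t. \<bar>\<Phi> t\<bar> \<le> integral {a..b} (\<lambda>t. \<bar>\<psi> t\<bar>)"
    using compactly_supported_antiderivative[OF assms(1) 0(1,2)] 0(3)[of 0] by auto
  have "smooth \<Phi>" by (rule smooth_antiderivative[OF \<Phi>(1) 0(1)])
  moreover have "deriv \<Phi> = \<psi>" by (intro ext DERIV_imp_deriv \<Phi>(1))
  ultimately show ?case using \<Phi>(2,3) 0(4) order_trans by (intro exI[of _ \<Phi>]) fastforce
next
  case (Suc p)
  obtain \<Phi> where \<Phi>: "\<And>t. (\<Phi> has_real_derivative \<psi> t) (at t)"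
    "\<And>t. t \<notin> {a<..<b} \<Longrightarrow> \<Phi> t = 0"
    "\<And>t. \<bar>\<Phi> t\<bar> \<le> integral {a..b} (\<lambda>t. \<bar>\<psi> t\<bar>)"
    using compactly_supported_antiderivative[OF assms(1) Suc.prems(1,2)] Suc.prems(3)[of 0] by auto
  have sm: "smooth \<Phi>" by (rule smooth_antiderivative[OF \<Phi>(1) Suc.prems(1)])
  have d: "deriv \<Phi> = \<psi>" by (intro ext DERIV_imp_deriv \<Phi>(1))
  have cont: "continuous_on X \<psi>" "continuous_on X \<Phi>" for X
    using smooth_continuous_on sm Suc.prems(1) by auto
  have mom: "integral {a..b} (\<lambda>t. \<Phi> t * t ^ j) = 0" if "j \<le> p" for j
  proof -
    have "((\<lambda>t. \<Phi> t * t ^ Suc j / real (Suc j)) has_vector_derivative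
        \<psi> t * t ^ Suc j / real (Suc j) + \<Phi> t * t ^ j) (at t within {a..b})" for t
    proof -
      have "((\<lambda>t. \<Phi> t * t ^ Suc j / real (Suc j)) has_real_derivative
          (\<psi> t * t ^ Suc j + real (Suc j) * t ^ j * \<Phi> t) / real (Suc j)) (at t within {a..b})"
        by (rule derivative_eq_intros \<Phi>(1)[THEN DERIV_subset] refl | simp del: power_Suc of_nat_Suc)+
      then show ?thesis
        by (simp add: has_real_derivative_iff_has_vector_derivative add_divide_distrib mult.commute
            del: power_Suc of_nat_Suc)
    qed
    then have "((\<lambda>t. \<psi> t * t ^ Suc j / real (Suc j) + \<Phi> t * t ^ j) has_integral
        (\<Phi> b * b ^ Suc j / real (Suc j) - \<Phi> a * a ^ Suc j / real (Suc j))) {a..b}"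
      using assms(1) by (intro fundamental_theorem_of_calculus) auto
    then have "((\<lambda>t. \<psi> t * t ^ Suc j / real (Suc j) + \<Phi> t * t ^ j) has_integral 0) {a..b}"
      using \<Phi>(2)[of a] \<Phi>(2)[of b] by simp
    moreover have "((\<lambda>t. \<psi> t * t ^ Suc j / real (Suc j)) has_integral 0) {a..b}"
    proof -
      have "(\<lambda>t. \<psi> t * t ^ Suc j) integrable_on {a..b}"
        by (intro integrable_continuous_real continuous_intros cont)
      then have "((\<lambda>t. \<psi> t * t ^ Suc j) has_integral 0) {a..b}"
        using Suc.prems(3)[of "Suc j"] that integrable_integral by fastforce
      from has_integral_divide[OF this, of "real (Suc j)"] show ?thesis by simp
    qed
    ultimately have "((\<lambda>t. (\<psi> t * t ^ Suc j / real (Suc j) + \<Phi> t * t ^ j)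
        - \<psi> t * t ^ Suc j / real (Suc j)) has_integral 0 - 0) {a..b}"
      by (rule has_integral_diff)
    then have "((\<lambda>t. \<Phi> t * t ^ j) has_integral 0) {a..b}" by simp
    then show ?thesis by blast
  qed
  have "integral {a..b} (\<lambda>t. \<bar>\<Phi> t\<bar>) \<le> integral {a..b} (\<lambda>t. S)"
    using order_trans[OF \<Phi>(3) Suc.prems(4)]
    by (intro integral_le integrable_continuous_real continuous_intros cont) auto
  then have "integral {a..b} (\<lambda>t. \<bar>\<Phi> t\<bar>) \<le> (b - a) * S" using assms(1) by simp
  from Suc.IH[OF sm \<Phi>(2) mom this] obtain \<phi> where
    "smooth \<phi>" "\<forall>t. t \<notin> {a<..<b} \<longrightarrow> \<phi> t = 0" "(deriv ^^ Suc p) \<phi> = \<Phi>"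
    "\<forall>t. \<bar>\<phi> t\<bar> \<le> (b - a) ^ p * ((b - a) * S)" by blast
  with d show ?case by (intro exI[of _ \<phi>]) (auto simp: mult_ac)
qed

lemma integral_translated_mollifier:
  fixes s e a b :: real and h \<eta> :: "real \<Rightarrow> real"
  assumes "a \<le> s - e" "s + e \<le> b" and cont: "continuous_on {a..b} h" "continuous_on UNIV \<eta>"
    and supp: "\<And>t. \<bar>t\<bar> \<ge> e \<Longrightarrow> \<eta> t = 0"
  shows "((\<lambda>t. \<eta> t * h (t + s)) has_integral integral {a..b} (\<lambda>t. \<eta> (t - s) * h t)) {-e..e}"
proof -
  have "continuous_on {-e..e} \<eta>" by (rule continuous_on_subset[OF cont(2)]) simp
  moreover have "continuous_on {-e..e} (\<lambda>t. h (t + s))"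
    by (rule continuous_on_compose2[OF cont(1)]) (use assms(1,2) in \<open>auto intro!: continuous_intros\<close>)
  ultimately have "continuous_on {-e..e} (\<lambda>t. \<eta> t * h (t + s))" by (intro continuous_intros)
  then have "((\<lambda>t. \<eta> t * h (t + s)) has_integral integral {-e..e} (\<lambda>t. \<eta> t * h (t + s))) {-e..e}"
    by (intro integrable_integral integrable_continuous_real)
  moreover from this have "((\<lambda>t. \<eta> t * h (t + s)) has_integral
      integral {-e..e} (\<lambda>t. \<eta> t * h (t + s))) {a - s..b - s}"
    by (rule has_integral_on_superset) (use assms(1,2) supp in auto)
  then have "integral {a - s..b - s} (\<lambda>t. \<eta> t * h (t + s)) = integral {-e..e} (\<lambda>t. \<eta> t * h (t + s))"
    by blast
  then have "integral {a..b} (\<lambda>t. \<eta> (t - s) * h t) = integral {-e..e} (\<lambda>t. \<eta> t * h (t + s))"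
    using integral_shift_real_ivl[of a s b "\<lambda>t. \<eta> (t - s) * h t"] by simp
  ultimately show ?thesis by simp
qed

text \<open>A point functional that annihilates the monomials also annihilates their translates, by the binomial
  theorem.\<close>

lemma shifted_moments_vanish:
  fixes c s :: "'i \<Rightarrow> real"
  assumes "\<And>k. k \<le> j \<Longrightarrow> (\<Sum>i\<in>I. c i * s i ^ k) = 0"
  shows "(\<Sum>i\<in>I. c i * (t + s i) ^ j) = 0"
proof -
  have "(\<Sum>i\<in>I. c i * (t + s i) ^ j) =
      (\<Sum>i\<in>I. \<Sum>k\<le>j. real (j choose k) * t ^ (j - k) * (c i * s i ^ k))"
    by (simp add: binomial_ring[of "s _" t] add.commute[of t] sum_distrib_left mult_ac)
  also have "\<dots> = (\<Sum>k\<le>j. real (j choose k) * t ^ (j - k) * (\<Sum>i\<in>I. c i * s i ^ k))"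
    by (subst sum.swap) (simp add: sum_distrib_left)
  also have "\<dots> = 0" using assms by (intro sum.neutral) auto
  finally show ?thesis .
qed

text \<open>The weak form of Peano's kernel theorem. If \<open>g\<close> were \<open>p + 1\<close> times differentiable, the functional
  \<open>\<Sum> c\<^sub>i g(s\<^sub>i)\<close> would be the integral of \<open>g\<^sup>(\<^sup>p\<^sup>+\<^sup>1\<^sup>)\<close> against a spline. Here the point masses are replaced
  by \<open>\<psi> = \<Sum> c\<^sub>i \<eta>(\<cdot> - s\<^sub>i)\<close> with a mollifier \<open>\<eta>\<close>, so that the spline becomes the test function \<open>\<phi>\<close> with
  \<open>\<phi>\<^sup>(\<^sup>p\<^sup>+\<^sup>1\<^sup>) = \<psi>\<close>. The uniform continuity of \<open>g\<close> makes the effect of the mollification arbitrarily small.\<close>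

lemma weak_deriv_functional_bound:
  fixes g w :: "real \<Rightarrow> real" and c s :: "'i \<Rightarrow> real"
  assumes weak: "has_weak_deriv (Suc p) 0 T g w"
    and cont: "continuous_on {a..b} g"
    and ab: "0 < a" "a < b" "b < T"
    and I: "finite I" "\<And>i. i \<in> I \<Longrightarrow> a < s i \<and> s i < b"
    and mom: "\<And>j. j \<le> p \<Longrightarrow> (\<Sum>i\<in>I. c i * s i ^ j) = 0"
  shows "\<bar>\<Sum>i\<in>I. c i * g (s i)\<bar>
      \<le> (b - a) ^ p * (\<Sum>i\<in>I. \<bar>c i\<bar>) * (LINT t:{a..b}|lebesgue. \<bar>w t\<bar>)"
proof (rule field_le_epsilon)
  fix d :: real assume "d > 0"
  define S where "S = (\<Sum>i\<in>I. \<bar>c i\<bar>)"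
  have S: "S \<ge> 0" by (simp add: S_def sum_nonneg)
  \<comment> \<open>The denominator is \<open>S + 1\<close> rather than \<open>S\<close> because all coefficients may be zero.\<close>
  define d' where "d' = d / (S + 1)"
  have d': "d' > 0" "S * d' \<le> d"
    using \<open>d > 0\<close> S by (auto simp: d'_def field_simps)
  have "uniformly_continuous_on {a..b} g"
    by (rule compact_uniformly_continuous[OF cont]) simp
  then obtain r where r: "r > 0" "\<And>x y. x \<in> {a..b} \<Longrightarrow> y \<in> {a..b} \<Longrightarrow> \<bar>y - x\<bar> < r \<Longrightarrow> \<bar>g y - g x\<bar> < d'"
    using d'(1) unfolding uniformly_continuous_on_def dist_real_def by metis
  have "\<forall>\<^sub>F e in at_right 0. \<forall>i\<in>I. a < s i - e \<and> s i + e < b"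
  proof (intro eventually_ball_finite I(1) ballI)
    fix i assume "i \<in> I"
    then show "\<forall>\<^sub>F e in at_right 0. a < s i - e \<and> s i + e < b"
      unfolding eventually_at_right_field using I(2)
      by (intro exI[of _ "min (s i - a) (b - s i)"]) auto
  qed
  moreover have "\<forall>\<^sub>F e in at_right 0. e < r"
    unfolding eventually_at_right_field using r(1) by blast
  ultimately have "\<forall>\<^sub>F e in at_right 0. 0 < e \<and> e < r \<and> (\<forall>i\<in>I. a < s i - e \<and> s i + e < b)"
    using eventually_at_right_less[of "0::real"] by eventually_elim auto
  from eventually_happens'[OF trivial_limit_at_right_real this]
  obtain e where e: "0 < e" "e < r" "\<And>i. i \<in> I \<Longrightarrow> a < s i - e \<and> s i + e < b"
    by blast
  obtain \<eta> where \<eta>: "smooth \<eta>" "\<And>t. \<eta> t \<ge> 0" "\<And>t. \<bar>t\<bar> \<ge> e \<Longrightarrow> \<eta> t = 0" "integral {-e..e} \<eta> = 1"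
    using mollifier_exists[OF e(1)] by blast
  have \<eta>c: "continuous_on X \<eta>" for X by (rule smooth_continuous_on[OF \<eta>(1)])
  have \<eta>1: "(\<eta> has_integral 1) {-e..e}"
    using integrable_integral[OF integrable_continuous_real[OF \<eta>c]] \<eta>(4) by metis
  define \<psi> where "\<psi> t = (\<Sum>i\<in>I. c i * \<eta> (t - s i))" for t
  have sm: "smooth \<psi>"
    unfolding \<psi>_def using smooth_cmult_affine[OF \<eta>(1), of _ 1 "- s _"]
    by (intro smooth_sum I) simp
  have supp: "\<psi> t = 0" if "t \<notin> {a<..<b}" for t
    unfolding \<psi>_def using e(3) that by (intro sum.neutral) (force intro!: \<eta>(3))
  have shift: "((\<lambda>t. \<Sum>i\<in>I. k i * (\<eta> t * h (t + s i))) has_integral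
      integral {a..b} (\<lambda>t. (\<Sum>i\<in>I. k i * \<eta> (t - s i)) * h t)) {-e..e}"
    if h: "continuous_on {a..b} h" for h and k :: "'i \<Rightarrow> real"
  proof -
    have "((\<lambda>t. \<Sum>i\<in>I. k i * (\<eta> t * h (t + s i))) has_integral
        (\<Sum>i\<in>I. k i * integral {a..b} (\<lambda>t. \<eta> (t - s i) * h t))) {-e..e}"
      using e(3) by (intro has_integral_sum I has_integral_mult_right
          integral_translated_mollifier h \<eta>c \<eta>(3)) force+
    also have "(\<Sum>i\<in>I. k i * integral {a..b} (\<lambda>t. \<eta> (t - s i) * h t)) =
        integral {a..b} (\<lambda>t. (\<Sum>i\<in>I. k i * \<eta> (t - s i)) * h t)"
      unfolding sum_distrib_right mult.assoc
      by (subst integral_sum)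
         (auto intro!: I integrable_continuous_real continuous_intros h continuous_on_compose2[OF \<eta>c[of UNIV]])
    finally show ?thesis .
  qed
  \<comment> \<open>The moments of \<open>\<psi>\<close> are averages, with weight \<open>\<eta>\<close>, of translated moments of the functional.\<close>
  have \<psi>mom: "integral {a..b} (\<lambda>t. \<psi> t * t ^ j) = 0" if "j \<le> p" for j
  proof -
    have "(\<Sum>i\<in>I. c i * (\<eta> t * (t + s i) ^ j)) = \<eta> t * (\<Sum>i\<in>I. c i * (t + s i) ^ j)" for t
      by (simp add: sum_distrib_left mult_ac)
    then have "(\<Sum>i\<in>I. c i * (\<eta> t * (t + s i) ^ j)) = 0" for t
      using shifted_moments_vanish[of j c s I] mom that by simp
    moreover have "continuous_on {a..b} (\<lambda>t. t ^ j)" by (intro continuous_intros)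
    ultimately show ?thesis using shift[of "\<lambda>t. t ^ j" c] by (simp add: \<psi>_def)
  qed
  have "integral {a..b} (\<lambda>t. \<bar>\<psi> t\<bar>) \<le> integral {a..b} (\<lambda>t. (\<Sum>i\<in>I. \<bar>c i\<bar> * \<eta> (t - s i)) * 1)"
  proof (intro integral_le)
    show "(\<lambda>t. (\<Sum>i\<in>I. \<bar>c i\<bar> * \<eta> (t - s i)) * 1) integrable_on {a..b}"
      by (auto intro!: integrable_continuous_real continuous_intros continuous_on_compose2[OF \<eta>c[of UNIV]])
    fix t
    have "\<bar>\<psi> t\<bar> \<le> (\<Sum>i\<in>I. \<bar>c i * \<eta> (t - s i)\<bar>)" unfolding \<psi>_def by (rule sum_abs)
    then show "\<bar>\<psi> t\<bar> \<le> (\<Sum>i\<in>I. \<bar>c i\<bar> * \<eta> (t - s i)) * 1" using \<eta>(2) by (simp add: abs_mult)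
  qed (intro integrable_continuous_real continuous_intros smooth_continuous_on sm)
  also have "\<dots> = S"
  proof -
    have "((\<lambda>t. \<Sum>i\<in>I. \<bar>c i\<bar> * (\<eta> t * 1)) has_integral (\<Sum>i\<in>I. \<bar>c i\<bar> * 1)) {-e..e}"
      by (intro has_integral_sum I has_integral_mult_right) (use \<eta>1 in simp)
    with shift[of "\<lambda>_. 1" "\<lambda>i. \<bar>c i\<bar>"] show ?thesis
      by (auto dest: has_integral_unique simp: S_def)
  qed
  finally have "integral {a..b} (\<lambda>t. \<bar>\<psi> t\<bar>) \<le> S" .
  from vanishing_moments_imp_iterated_derivative[OF ab(2) sm supp \<psi>mom this]
  obtain \<phi> where \<phi>: "smooth \<phi>" "\<And>t. t \<notin> {a<..<b} \<Longrightarrow> \<phi> t = 0" "(deriv ^^ Suc p) \<phi> = \<psi>"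
    "\<And>t. \<bar>\<phi> t\<bar> \<le> (b - a) ^ p * S" by blast
  have "test_function 0 T \<phi>"
    unfolding test_function_def using smooth_differentiable[OF \<phi>(1)] \<phi>(2) ab
    by (auto intro!: exI[of _ "{a..b}"])
  then have pair: "(LINT t:{0<..<T}|lebesgue. g t * \<psi> t) =
      (-1) ^ Suc p * (LINT t:{0<..<T}|lebesgue. w t * \<phi> t)"
    using weak \<phi>(3) unfolding has_weak_deriv_def by metis
  have w_int: "set_integrable lebesgue {a..b} (\<lambda>t. \<bar>w t\<bar>)"
  proof -
    have "set_integrable lebesgue {0<..<T} w" using weak by (simp add: has_weak_deriv_def)
    then have "set_integrable lebesgue {a..b} w"
      by (rule set_integrable_subset) (use ab in auto)
    then show ?thesis by (rule set_integrable_abs)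
  qed
  have "\<bar>LINT t:{0<..<T}|lebesgue. w t * \<phi> t\<bar>
      \<le> (LINT t|lebesgue. \<bar>indicator {0<..<T} t * (w t * \<phi> t)\<bar>)"
    unfolding set_lebesgue_integral_def using integral_norm_bound[of lebesgue] by simp
  also have "\<dots> \<le> (LINT t|lebesgue. (b - a) ^ p * S * (indicator {a..b} t * \<bar>w t\<bar>))"
  proof (rule Bochner_Integration.integral_mono')
    show "integrable lebesgue (\<lambda>t. (b - a) ^ p * S * (indicator {a..b} t * \<bar>w t\<bar>))"
      using w_int by (simp add: set_integrable_def)
    fix t
    show "\<bar>indicator {0<..<T} t * (w t * \<phi> t)\<bar> \<le> (b - a) ^ p * S * (indicator {a..b} t * \<bar>w t\<bar>)"
    proof (cases "t \<in> {a<..<b}")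
      case True
      then show ?thesis
        using ab mult_left_mono[OF \<phi>(4)[of t], of "\<bar>w t\<bar>"] by (simp add: abs_mult mult_ac)
    next
      case False
      then show ?thesis using \<phi>(2)[OF False] S ab by simp
    qed
  qed (use S ab in auto)
  also have "\<dots> = (b - a) ^ p * S * (LINT t:{a..b}|lebesgue. \<bar>w t\<bar>)"
    by (simp add: set_lebesgue_integral_def)
  finally have wbound: "\<bar>LINT t:{0<..<T}|lebesgue. g t * \<psi> t\<bar>
      \<le> (b - a) ^ p * S * (LINT t:{a..b}|lebesgue. \<bar>w t\<bar>)"
    by (simp add: pair abs_mult power_abs)
  have "(LINT t:{0<..<T}|lebesgue. g t * \<psi> t) = (LINT t:{a..b}|lebesgue. \<psi> t * g t)"
    unfolding set_lebesgue_integral_def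
    by (rule Bochner_Integration.integral_cong) (use ab supp in \<open>auto simp: indicator_def\<close>)
  also have "\<dots> = integral {a..b} (\<lambda>t. \<psi> t * g t)"
    by (intro set_lebesgue_integral_eq_integral absolutely_integrable_continuous_real
        continuous_intros cont smooth_continuous_on sm)
  finally have lhs: "(LINT t:{0<..<T}|lebesgue. g t * \<psi> t) = integral {a..b} (\<lambda>t. \<psi> t * g t)" .
  \<comment> \<open>The mollified functional minus the original one, written as a single integral against \<open>\<eta>\<close>.\<close>
  have "((\<lambda>t. (\<Sum>i\<in>I. c i * (\<eta> t * g (t + s i))) - (\<Sum>i\<in>I. c i * g (s i)) * \<eta> t) has_integral
      integral {a..b} (\<lambda>t. \<psi> t * g t) - (\<Sum>i\<in>I. c i * g (s i)) * 1) {-e..e}"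
    unfolding \<psi>_def by (intro has_integral_diff shift cont has_integral_mult_right \<eta>1)
  moreover have "((\<lambda>t. S * d' * \<eta> t) has_integral S * d' * 1) {-e..e}"
    by (intro has_integral_mult_right \<eta>1)
  moreover have "\<bar>(\<Sum>i\<in>I. c i * (\<eta> t * g (t + s i))) - (\<Sum>i\<in>I. c i * g (s i)) * \<eta> t\<bar> \<le> S * d' * \<eta> t"
    if t: "t \<in> {-e..e}" for t
  proof -
    have "\<bar>(\<Sum>i\<in>I. c i * (\<eta> t * g (t + s i))) - (\<Sum>i\<in>I. c i * g (s i)) * \<eta> t\<bar> =
        \<bar>\<Sum>i\<in>I. \<eta> t * (c i * (g (t + s i) - g (s i)))\<bar>"
      by (simp add: sum_distrib_left sum_distrib_right sum_subtractf algebra_simps)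
    also have "\<dots> \<le> (\<Sum>i\<in>I. \<bar>\<eta> t * (c i * (g (t + s i) - g (s i)))\<bar>)" by (rule sum_abs)
    also have "\<dots> \<le> (\<Sum>i\<in>I. \<eta> t * (\<bar>c i\<bar> * d'))"
    proof (rule sum_mono)
      fix i assume i: "i \<in> I"
      have "\<bar>g (t + s i) - g (s i)\<bar> \<le> d'"
        using r(2)[of "s i" "t + s i"] e(2) e(3)[OF i] I(2)[OF i] t by force
      then show "\<bar>\<eta> t * (c i * (g (t + s i) - g (s i)))\<bar> \<le> \<eta> t * (\<bar>c i\<bar> * d')"
        using \<eta>(2)[of t] by (simp add: abs_mult mult_left_mono)
    qed
    also have "\<dots> = S * d' * \<eta> t" by (simp add: S_def sum_distrib_left sum_distrib_right mult_ac)
    finally show ?thesis .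
  qed
  ultimately have "\<bar>integral {a..b} (\<lambda>t. \<psi> t * g t) - (\<Sum>i\<in>I. c i * g (s i))\<bar> \<le> S * d'"
    using integral_norm_bound_integral[of
        "\<lambda>t. (\<Sum>i\<in>I. c i * (\<eta> t * g (t + s i))) - (\<Sum>i\<in>I. c i * g (s i)) * \<eta> t" "{-e..e}"
        "\<lambda>t. S * d' * \<eta> t"] \<eta>(4)
    by (simp add: has_integral_iff)
  with wbound lhs d'(2) show "\<bar>\<Sum>i\<in>I. c i * g (s i)\<bar>
      \<le> (b - a) ^ p * (\<Sum>i\<in>I. \<bar>c i\<bar>) * (LINT t:{a..b}|lebesgue. \<bar>w t\<bar>) + d"
    unfolding S_def by linarith
qed

section \<open>Backward interpolation and consistency of the Adams--Bashforth scheme\<close>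

text \<open>The Lagrange basis polynomial of the node \<open>1 - m\<close> for the nodes \<open>0, -1, \<dots>, 1 - M\<close>. These are the times
  \<open>t\<^sub>n\<^sub>-\<^sub>m\<close> measured from \<open>t\<^sub>n\<^sub>-\<^sub>1\<close> in units of \<open>h\<close>.\<close>

definition backward_lagrange :: "nat \<Rightarrow> nat \<Rightarrow> real poly" where
  "backward_lagrange M m =
     smult ((-1) ^ (m - 1) / (fact (m - 1) * fact (M - m))) (\<Prod>i\<in>{0..M - 1} - {m - 1}. [:real i, 1:])"

lemma prod_differences_to_node:
  assumes "1 \<le> m" "m \<le> M"
  shows "(\<Prod>i\<in>{0..M - 1} - {m - 1}. real i - real (m - 1)) = (-1) ^ (m - 1) * fact (m - 1) * fact (M - m)"
proof -
  have "(\<Prod>i<n. real i - real n) = (-1) ^ n * fact n" for n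
  proof -
    have "(\<Prod>i<n. real i - real n) = (\<Prod>i<n. real (n - Suc i) - real n)"
      by (rule prod.nat_diff_reindex[symmetric])
    also have "\<dots> = (\<Prod>i<n. (-1) * real (Suc i))" by (rule prod.cong) (auto simp: of_nat_diff)
    also have "\<dots> = (-1) ^ n * fact n"
      unfolding prod.distrib by (simp add: fact_prod_Suc lessThan_atLeast0 del: of_nat_Suc)
    finally show ?thesis .
  qed
  moreover have "(\<Prod>i\<in>{m..<M}. real i - real (m - 1)) = fact (M - m)"
  proof -
    have "(\<Prod>i\<in>{m..<M}. real i - real (m - 1)) = (\<Prod>i\<in>{0..<M - m}. real (Suc i))"
      by (rule prod.reindex_bij_witness[of _ "\<lambda>i. i + m" "\<lambda>i. i - m"])
         (use assms in \<open>auto simp: of_nat_diff\<close>)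
    then show ?thesis by (simp add: fact_prod_Suc del: of_nat_Suc)
  qed
  moreover have "{0..M - 1} - {m - 1} = {..<m - 1} \<union> {m..<M}" using assms by auto
  moreover have "{..<m - 1} \<inter> {m..<M} = {}" by auto
  ultimately show ?thesis
    by (simp only: prod.union_disjoint finite_lessThan finite_atLeastLessThan)
qed

lemma backward_lagrange_at_nodes:
  assumes "m \<in> {1..M}" "k \<in> {1..M}"
  shows "poly (backward_lagrange M m) (1 - real k) = (if k = m then 1 else 0)"
proof (cases "k = m")
  case True
  have "(\<Prod>i\<in>{0..M - 1} - {m - 1}. 1 - real m + real i) =
      (\<Prod>i\<in>{0..M - 1} - {m - 1}. real i - real (m - 1))"
    using assms by (intro prod.cong) (auto simp: of_nat_diff)
  also have "\<dots> = (-1) ^ (m - 1) * fact (m - 1) * fact (M - m)"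
    using assms by (intro prod_differences_to_node) auto
  finally have "poly (backward_lagrange M m) (1 - real m) =
      (-1) ^ (m - 1) / (fact (m - 1) * fact (M - m)) * ((-1) ^ (m - 1) * fact (m - 1) * fact (M - m))"
    by (simp add: backward_lagrange_def poly_prod add.commute)
  also have "\<dots> = ((-1) * (-1)) ^ (m - 1)" unfolding power_mult_distrib by simp
  finally show ?thesis using True by simp
next
  case False
  then have "k - 1 \<in> {0..M - 1} - {m - 1}" using assms by auto
  moreover have "poly [:real (k - 1), 1:] (1 - real k) = 0" using assms by (simp add: of_nat_diff)
  ultimately have "(\<Prod>i\<in>{0..M - 1} - {m - 1}. poly [:real i, 1:] (1 - real k)) = 0"
    by (intro prod_zero) blast+
  then show ?thesis using False by (simp add: backward_lagrange_def poly_prod)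
qed

lemma degree_backward_lagrange:
  assumes "m \<in> {1..M}"
  shows "degree (backward_lagrange M m) < M"
proof -
  have "degree (\<Prod>i\<in>{0..M - 1} - {m - 1}. [:real i, 1:]) \<le> (\<Sum>i\<in>{0..M - 1} - {m - 1}. 1)"
    using degree_prod_sum_le[of "{0..M - 1} - {m - 1}" "\<lambda>i. [:real i, 1:]"] by simp
  also have "\<dots> < M" using assms by (auto simp: card_Diff_singleton_if)
  finally show ?thesis using degree_smult_le le_less_trans unfolding backward_lagrange_def by blast
qed

lemma backward_lagrange_interpolation:
  assumes "degree Q < M"
  shows "poly Q s = (\<Sum>m=1..M. poly (backward_lagrange M m) s * poly Q (1 - real m))"
proof -
  define P where "P = (\<Sum>m=1..M. smult (poly Q (1 - real m)) (backward_lagrange M m))"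
  have "degree P < M"
    unfolding P_def using assms degree_backward_lagrange degree_smult_le le_less_trans
    by (intro degree_sum_less) blast+
  moreover have "card ((\<lambda>k. 1 - real k) ` {1..M}) = M"
    by (subst card_image) (auto intro: inj_onI)
  moreover have "poly Q x = poly P x" if "x \<in> (\<lambda>k. 1 - real k) ` {1..M}" for x
  proof -
    from that obtain k where k: "k \<in> {1..M}" "x = 1 - real k" by blast
    have "poly P x = (\<Sum>m=1..M. if k = m then poly Q (1 - real m) else 0)"
      unfolding P_def k(2) poly_sum poly_smult
      by (intro sum.cong refl) (use backward_lagrange_at_nodes k(1) in auto)
    also have "\<dots> = poly Q x" using k by simp
    finally show ?thesis by simp
  qed
  ultimately have "Q = P" using assms by (intro poly_eqI_degree[of "(\<lambda>k. 1 - real k) ` {1..M}"]) auto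
  then have "poly Q s = poly P s" by simp
  then show ?thesis by (simp add: P_def poly_sum mult.commute)
qed

lemma backward_lagrange_bound:
  assumes "m \<in> {1..M}" "0 \<le> s" "s \<le> 1"
  shows "\<bar>poly (backward_lagrange M m) s\<bar> \<le> real M ^ M"
proof -
  have "\<bar>poly (\<Prod>i\<in>{0..M - 1} - {m - 1}. [:real i, 1:]) s\<bar> = (\<Prod>i\<in>{0..M - 1} - {m - 1}. \<bar>s + real i\<bar>)"
    by (simp add: poly_prod abs_prod add.commute)
  also have "\<dots> \<le> (\<Prod>i\<in>{0..M - 1} - {m - 1}. real M)"
    using assms by (intro prod_mono) auto
  also have "\<dots> = real M ^ (M - 1)" using assms by (auto simp: card_Diff_singleton_if)
  also have "\<dots> \<le> real M ^ M" using assms by (intro power_increasing) auto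
  finally have *: "\<bar>poly (\<Prod>i\<in>{0..M - 1} - {m - 1}. [:real i, 1:]) s\<bar> \<le> real M ^ M" .
  have "1 \<le> (fact (m - 1) * fact (M - m) :: real)"
    using mult_mono[of 1 "fact (m - 1) :: real" 1 "fact (M - m)"] by (simp add: fact_ge_1)
  then have "\<bar>(-1) ^ (m - 1) / (fact (m - 1) * fact (M - m) :: real)\<bar> \<le> 1"
    by (simp add: abs_mult power_abs)
  from mult_mono[OF this *] show ?thesis by (simp add: backward_lagrange_def abs_mult)
qed

lemma ab_beta_eq_integral:
  assumes "m \<in> {1..M}"
  shows "ab_beta M m = integral {0..1} (poly (backward_lagrange M m))"
proof -
  have "poly (backward_lagrange M m) = (\<lambda>u. (-1) ^ (m - 1) / (fact (m - 1) * fact (M - m)) *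
      (\<Prod>i\<in>{0..M - 1} - {m - 1}. (u + real i)))"
    by (rule ext) (simp add: backward_lagrange_def poly_prod add.commute)
  then show ?thesis using assms by (simp add: ab_beta_def)
qed

text \<open>The weights are the integrals of the Lagrange basis, so the scheme integrates the polynomial \<open>Q'\<close>
  of degree below \<open>M\<close> exactly over one step.\<close>

lemma ab_exact_on_polynomials:
  assumes "M \<ge> 1" "degree Q \<le> M"
  shows "poly Q 1 - poly Q 0 = (\<Sum>m=1..M. ab_beta M m * poly (pderiv Q) (1 - real m))"
proof -
  have "(poly (pderiv Q) has_integral poly Q 1 - poly Q 0) {0..1}"
    by (intro fundamental_theorem_of_calculus)
       (auto simp flip: has_real_derivative_iff_has_vector_derivative intro: poly_DERIV DERIV_subset)
  moreover have "(poly (pderiv Q) has_integral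
      (\<Sum>m=1..M. ab_beta M m * poly (pderiv Q) (1 - real m))) {0..1}"
  proof -
    have "((\<lambda>s. \<Sum>m=1..M. poly (backward_lagrange M m) s * poly (pderiv Q) (1 - real m)) has_integral
        (\<Sum>m=1..M. integral {0..1} (poly (backward_lagrange M m)) * poly (pderiv Q) (1 - real m))) {0..1}"
      by (intro has_integral_sum has_integral_mult_left integrable_integral
          integrable_continuous_real continuous_intros) auto
    moreover have "degree (pderiv Q) < M" using assms by (simp add: degree_pderiv)
    then have "poly (pderiv Q) =
        (\<lambda>s. \<Sum>m=1..M. poly (backward_lagrange M m) s * poly (pderiv Q) (1 - real m))"
      by (intro ext backward_lagrange_interpolation)
    moreover have "(\<Sum>m=1..M. ab_beta M m * poly (pderiv Q) (1 - real m)) =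
        (\<Sum>m=1..M. integral {0..1} (poly (backward_lagrange M m)) * poly (pderiv Q) (1 - real m))"
      by (intro sum.cong refl) (simp add: ab_beta_eq_integral)
    ultimately show ?thesis by metis
  qed
  ultimately show ?thesis by (rule has_integral_unique)
qed

text \<open>This is the leading coefficient of the characteristic polynomial, so it determines the order of the
  recurrence. On \<open>[0, 1]\<close> its integrand is a product of factors \<open>u + i\<close> with \<open>i \<ge> 1\<close>.\<close>

lemma ab_beta_1_pos:
  assumes "M \<ge> 1"
  shows "ab_beta M 1 > 0"
proof -
  have "integral {0..1} (\<lambda>u::real. 1) \<le> integral {0..1} (\<lambda>u::real. \<Prod>i\<in>{0..M - 1} - {0}. (u + real i))"
  proof (intro integral_le)
    fix u :: real assume "u \<in> {0..1}"
    then show "1 \<le> (\<Prod>i\<in>{0..M - 1} - {0}. (u + real i))" by (intro prod_ge_1) auto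
  qed (intro integrable_continuous_real continuous_intros)+
  then show ?thesis using assms by (simp add: ab_beta_def)
qed

text \<open>Replace the solution by its Taylor polynomial of degree \<open>M\<close> at \<open>t\<^sub>n\<^sub>-\<^sub>1\<close>, for which the scheme is exact. The
  remainder is \<open>O(h\<^sup>M\<^sup>+\<^sup>1)\<close> for the solution, which is divided by \<open>h\<close>, and \<open>O(h\<^sup>M)\<close> for its derivative.\<close>

lemma ab_truncation_error:
  fixes D :: "nat \<Rightarrow> real \<Rightarrow> real"
  assumes M: "M \<ge> 1" and h: "h > 0" and n: "M \<le> n" "real n * h \<le> T"
    and D: "\<And>j t. t \<in> {0..T} \<Longrightarrow> j \<le> M \<Longrightarrow> (D j has_real_derivative D (Suc j) t) (at t within {0..T})"
    and B: "\<And>t. t \<in> {0..T} \<Longrightarrow> \<bar>D (Suc M) t\<bar> \<le> B"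
  shows "\<bar>(\<Sum>m=1..M. ab_beta M m * D 1 (real (n - m) * h))
      - (D 0 (real n * h) - D 0 (real (n - 1) * h)) / h\<bar>
    \<le> (1 + real M ^ M * (\<Sum>m=1..M. \<bar>ab_beta M m\<bar>)) * B * h ^ M"
proof -
  obtain k where k: "M = Suc k" using M by (cases M) auto
  define a where "a = real (n - 1) * h"
  have mem: "real i * h \<in> {0..T}" if "i \<le> n" for i
  proof -
    have "real i * h \<le> real n * h" using h that by (intro mult_right_mono) auto
    with n(2) have "real i * h \<le> T" by linarith
    then show ?thesis using h by simp
  qed
  have a: "a \<in> {0..T}" unfolding a_def by (rule mem) simp
  have B0: "B \<ge> 0" using B[OF a] by linarith
  have diff: "real (n - m) * h - a = (1 - real m) * h" if "m \<le> M" for m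
    using that n(1) M by (simp add: a_def of_nat_diff algebra_simps)
  \<comment> \<open>The Taylor polynomial at \<open>a = t\<^sub>n\<^sub>-\<^sub>1\<close> in the rescaled variable \<open>(t - a) / h\<close>.\<close>
  define Q where "Q = (\<Sum>i\<le>M. monom (D i a * h ^ i / fact i) i)"
  have "degree Q \<le> M"
    unfolding Q_def by (intro degree_sum_le) (auto intro: order_trans[OF degree_monom_le])
  have Q1: "poly Q 1 = (\<Sum>i\<le>M. D i a * h ^ i / fact i)" by (simp add: Q_def poly_sum poly_monom)
  have Q0: "poly Q 0 = D 0 a"
    unfolding Q_def sum.atMost_shift by (simp add: poly_sum poly_monom)
  have Q': "poly (pderiv Q) x = h * (\<Sum>i\<le>k. D (Suc i) a * (x * h) ^ i / fact i)" for x
  proof -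
    have "pderiv Q = (\<Sum>i\<le>Suc k. monom (real i * (D i a * h ^ i / fact i)) (i - 1))"
      by (simp add: Q_def k higher_pderiv_sum[of 1, simplified] pderiv_monom del: sum.atMost_Suc)
    also have "\<dots> = (\<Sum>i\<le>k. monom (real (Suc i) * (D (Suc i) a * h ^ Suc i / fact (Suc i))) i)"
      by (subst sum.atMost_Suc_shift) simp
    also have "\<dots> = (\<Sum>i\<le>k. monom (D (Suc i) a * h ^ Suc i / fact i) i)"
      by (intro sum.cong refl arg_cong2[of _ _ _ _ monom]) (simp add: field_simps del: of_nat_Suc)
    finally show ?thesis
      by (simp add: poly_sum poly_monom sum_distrib_left power_mult_distrib mult_ac)
  qed
  have T0: "\<bar>D 0 (real n * h) - poly Q 1\<bar> \<le> B * h ^ Suc M"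
  proof -
    have "norm (D 0 (real n * h) - (\<Sum>i\<le>M. D i a * (real n * h - a) ^ i / fact i))
        \<le> B * norm (real n * h - a) ^ Suc M / fact M"
      by (rule field_Taylor[of "{0..T}"]) (use D B a mem in auto)
    moreover have "real n * h - a = h" using diff[of 0] by simp
    moreover have "B * h ^ Suc M / fact M \<le> B * h ^ Suc M / 1"
      using B0 h by (intro divide_left_mono) (auto simp: fact_ge_1)
    ultimately show ?thesis using Q1 h by simp
  qed
  have T1: "\<bar>D 1 (real (n - m) * h) - poly (pderiv Q) (1 - real m) / h\<bar> \<le> B * real M ^ M * h ^ M"
    if m: "m \<in> {1..M}" for m
  proof -
    have "norm (D (Suc 0) (real (n - m) * h) - (\<Sum>i\<le>k. D (Suc i) a * (real (n - m) * h - a) ^ i / fact i))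
        \<le> B * norm (real (n - m) * h - a) ^ Suc k / fact k"
      by (rule field_Taylor[of "{0..T}" k "\<lambda>i. D (Suc i)"]) (use D B a mem k in auto)
    moreover have "(\<Sum>i\<le>k. D (Suc i) a * (real (n - m) * h - a) ^ i / fact i) = poly (pderiv Q) (1 - real m) / h"
      using diff[of m] m h by (simp add: Q')
    moreover have "B * norm (real (n - m) * h - a) ^ Suc k / fact k \<le> B * (real M * h) ^ M"
    proof -
      have "norm (real (n - m) * h - a) \<le> real M * h"
        using diff[of m] m h by (simp add: abs_mult)
      then have "B * norm (real (n - m) * h - a) ^ Suc k \<le> B * (real M * h) ^ M"
        unfolding k using B0 by (intro mult_left_mono power_mono) auto
      moreover have "B * norm (real (n - m) * h - a) ^ Suc k / fact k \<le> B * norm (real (n - m) * h - a) ^ Suc k / 1"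
        using B0 by (intro divide_left_mono mult_nonneg_nonneg) (auto simp: fact_ge_1)
      ultimately show ?thesis by simp
    qed
    ultimately show ?thesis by (simp add: power_mult_distrib mult_ac)
  qed
  have "(\<Sum>m=1..M. ab_beta M m * D 1 (real (n - m) * h)) - (D 0 (real n * h) - D 0 (real (n - 1) * h)) / h =
      (\<Sum>m=1..M. ab_beta M m * (D 1 (real (n - m) * h) - poly (pderiv Q) (1 - real m) / h))
      - (D 0 (real n * h) - poly Q 1) / h"
    (is "?lhs = ?S - ?E")
  proof -
    have "?S = (\<Sum>m=1..M. ab_beta M m * D 1 (real (n - m) * h)) -
        (\<Sum>m=1..M. ab_beta M m * poly (pderiv Q) (1 - real m)) / h"
      by (simp add: right_diff_distrib sum_subtractf sum_divide_distrib)
    also have "(\<Sum>m=1..M. ab_beta M m * poly (pderiv Q) (1 - real m)) / h =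
        (poly Q 1 - D 0 (real (n - 1) * h)) / h"
      using ab_exact_on_polynomials[OF M \<open>degree Q \<le> M\<close>] Q0 by (simp only: a_def)
    finally show ?thesis by (simp add: diff_divide_distrib)
  qed
  moreover have "\<bar>?S\<bar> \<le> (\<Sum>m=1..M. \<bar>ab_beta M m\<bar> * (B * real M ^ M * h ^ M))"
    by (rule order_trans[OF sum_abs sum_mono]) (auto simp only: abs_mult intro!: mult_left_mono T1)
  moreover have "\<bar>?E\<bar> \<le> B * h ^ M"
    using T0 h by (simp add: field_simps)
  moreover have "(\<Sum>m=1..M. \<bar>ab_beta M m\<bar> * (B * real M ^ M * h ^ M)) =
      real M ^ M * (\<Sum>m=1..M. \<bar>ab_beta M m\<bar>) * B * h ^ M"
    by (simp add: sum_distrib_left sum_distrib_right mult_ac)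
  moreover have "(1 + real M ^ M * (\<Sum>m=1..M. \<bar>ab_beta M m\<bar>)) * B * h ^ M =
      B * h ^ M + real M ^ M * (\<Sum>m=1..M. \<bar>ab_beta M m\<bar>) * B * h ^ M"
    by (simp only: distrib_right mult_1_left)
  ultimately show ?thesis by linarith
qed

section \<open>Linear recurrences with roots inside the unit disc\<close>

text \<open>The polynomial \<open>q\<close> evaluated at the shift operator of sequences.\<close>

definition shift_poly :: "'a::comm_ring_1 poly \<Rightarrow> (nat \<Rightarrow> 'a) \<Rightarrow> nat \<Rightarrow> 'a" where
  "shift_poly q g n = (\<Sum>k\<le>degree q. coeff q k * g (n + k))"

text \<open>Products of polynomials act as compositions of operators, which reduces a recurrence to first-order ones.\<close>

lemma shift_poly_linear_factor:
  "shift_poly ([:-c, 1:] * q) g n = shift_poly q (\<lambda>n. g (Suc n) - c * g n) n"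
proof -
  let ?d = "degree q"
  have le: "degree ([:-c, 1:] * q) \<le> Suc ?d"
    using degree_mult_le[of "[:-c, 1:]" q] by (simp add: le_trans)
  have "shift_poly ([:-c, 1:] * q) g n = (\<Sum>k\<le>Suc ?d. coeff ([:-c, 1:] * q) k * g (n + k))"
    unfolding shift_poly_def using le
    by (intro sum.mono_neutral_left) (auto simp: coeff_eq_0 simp del: mult_pCons_left)
  also have "\<dots> = (\<Sum>k\<le>Suc ?d. coeff (pCons 0 q) k * g (n + k)) - (\<Sum>k\<le>Suc ?d. c * coeff q k * g (n + k))"
    by (simp only: sum_subtractf[symmetric] left_diff_distrib[symmetric])
       (simp add: mult_pCons_left del: sum.atMost_Suc)
  also have "(\<Sum>k\<le>Suc ?d. coeff (pCons 0 q) k * g (n + k)) = (\<Sum>k\<le>?d. coeff q k * g (n + Suc k))"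
    by (subst sum.atMost_Suc_shift) simp
  also have "(\<Sum>k\<le>Suc ?d. c * coeff q k * g (n + k)) = (\<Sum>k\<le>?d. c * coeff q k * g (n + k))"
    by (simp add: coeff_eq_0)
  finally show ?thesis
    by (simp add: shift_poly_def sum_subtractf[symmetric] algebra_simps)
qed

lemma first_order_recurrence_decay:
  fixes g :: "nat \<Rightarrow> 'a::real_normed_field"
  assumes \<rho>: "norm c \<le> \<rho>" "\<rho> < \<theta>" "\<theta> < 1" and AB: "A \<ge> 0" "B \<ge> 0"
    and w: "\<And>n. n < L \<Longrightarrow> norm (g (Suc n) - c * g n) \<le> A * \<theta> ^ n + B"
  shows "n \<le> L \<Longrightarrow> norm (g n) \<le> (norm (g 0) + A / (\<theta> - \<rho>)) * \<theta> ^ n + B / (1 - \<rho>)"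
proof (induction n)
  case 0
  then show ?case using \<rho> AB by simp
next
  case (Suc n)
  have \<rho>0: "0 \<le> \<rho>" using \<rho>(1) norm_ge_zero order_trans by blast
  have "norm (g (Suc n)) \<le> norm (c * g n) + norm (g (Suc n) - c * g n)"
    using norm_triangle_ineq[of "c * g n" "g (Suc n) - c * g n"] by simp
  also have "norm (c * g n) \<le> \<rho> * ((norm (g 0) + A / (\<theta> - \<rho>)) * \<theta> ^ n + B / (1 - \<rho>))"
    unfolding norm_mult using Suc \<rho>(1) \<rho>0 by (intro mult_mono) auto
  also have "norm (g (Suc n) - c * g n) \<le> A * \<theta> ^ n + B" using w Suc.prems by simp
  also have "\<rho> * ((norm (g 0) + A / (\<theta> - \<rho>)) * \<theta> ^ n + B / (1 - \<rho>)) + (A * \<theta> ^ n + B) =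
      \<rho> * norm (g 0) * \<theta> ^ n + (\<rho> * (A / (\<theta> - \<rho>)) + A) * \<theta> ^ n + (\<rho> * (B / (1 - \<rho>)) + B)"
    by (simp add: algebra_simps)
  also have "\<rho> * (A / (\<theta> - \<rho>)) + A = A / (\<theta> - \<rho>) * \<theta>" using \<rho> by (simp add: field_simps)
  also have "\<rho> * (B / (1 - \<rho>)) + B = B / (1 - \<rho>)" using \<rho> by (simp add: field_simps)
  also have "\<rho> * norm (g 0) * \<theta> ^ n \<le> \<theta> * norm (g 0) * \<theta> ^ n"
    using \<rho> \<rho>0 by (intro mult_right_mono) auto
  finally show ?case by (simp add: algebra_simps)
qed

text \<open>Split off one root \<open>z\<close> at a time: \<open>g(n+1) - z g(n)\<close> solves the recurrence of the cofactor, hence obeys the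
  bound by induction, and a first-order recurrence with \<open>\<bar>z\<bar> \<le> \<rho> < \<theta>\<close> reproduces bounds of the form
  \<open>A \<theta>\<^sup>n + B\<close>. The strict inequality \<open>\<rho> < \<theta>\<close> absorbs the polynomial factors that multiple roots cause. The
  recurrence is assumed only up to a horizon \<open>L\<close>, beyond which there are no grid values, and the constant
  \<open>K\<close> does not depend on \<open>L\<close>.\<close>

lemma recurrence_decay:
  fixes q :: "complex poly"
  assumes \<rho>: "0 \<le> \<rho>" "\<rho> < \<theta>" "\<theta> < 1"
    and q: "q \<noteq> 0" "\<And>z. poly q z = 0 \<Longrightarrow> norm z \<le> \<rho>"
  shows "\<exists>K\<ge>0. \<forall>g L A B. 0 \<le> A \<longrightarrow> 0 \<le> B \<longrightarrow>
    (\<forall>j<degree q. j \<le> L \<longrightarrow> norm (g j) \<le> A) \<longrightarrow>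
    (\<forall>n. n + degree q \<le> L \<longrightarrow> norm (shift_poly q g n) \<le> A * \<theta> ^ n + B) \<longrightarrow>
    (\<forall>n\<le>L. norm (g n) \<le> K * (A * \<theta> ^ n + B))"
  using q
proof (induction "degree q" arbitrary: q)
  case 0
  then obtain c where c: "q = [:c:]" "c \<noteq> 0" by (metis degree_eq_zeroE pCons_0_0)
  show ?case
    by (rule exI[of _ "1 / norm c"])
       (use c in \<open>auto simp: shift_poly_def norm_mult field_simps\<close>)
next
  case (Suc d)
  then obtain z where z: "poly q z = 0"
    using fundamental_theorem_of_algebra[of q] by (auto simp: constant_degree)
  then obtain r where r: "q = [:-z, 1:] * r" by (auto simp: poly_eq_0_iff_dvd)
  have r0: "r \<noteq> 0" using r Suc.prems(1) by auto
  have deg: "degree q = Suc (degree r)" unfolding r using r0 by (subst degree_mult_eq) auto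
  have zb: "norm z \<le> \<rho>" using Suc.prems(2) z by blast
  have "d = degree r" using Suc.hyps(2) deg by simp
  moreover have "norm y \<le> \<rho>" if "poly r y = 0" for y using Suc.prems(2)[of y] that r by simp
  ultimately obtain K where K: "K \<ge> 0"
    "\<And>g L A B n. 0 \<le> A \<Longrightarrow> 0 \<le> B \<Longrightarrow>
    (\<And>j. j < degree r \<Longrightarrow> j \<le> L \<Longrightarrow> norm (g j) \<le> A) \<Longrightarrow>
    (\<And>n. n + degree r \<le> L \<Longrightarrow> norm (shift_poly r g n) \<le> A * \<theta> ^ n + B) \<Longrightarrow>
    n \<le> L \<Longrightarrow> norm (g n) \<le> K * (A * \<theta> ^ n + B)"
    using Suc.hyps(1)[OF _ r0] by metis
  define K' where "K' = 1 + 2 * K / (\<theta> - \<rho>) + K / (1 - \<rho>)"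
  have parts: "0 \<le> 2 * K / (\<theta> - \<rho>)" "0 \<le> K / (1 - \<rho>)" using K(1) \<rho> by auto
  show ?case
  proof (intro exI[of _ K'] conjI allI impI)
    show "0 \<le> K'" using parts by (simp add: K'_def)
    fix g :: "nat \<Rightarrow> complex" and L n and A B :: real
    assume A: "0 \<le> A" and B: "0 \<le> B" and start: "\<forall>j<degree q. j \<le> L \<longrightarrow> norm (g j) \<le> A"
      and rec: "\<forall>n. n + degree q \<le> L \<longrightarrow> norm (shift_poly q g n) \<le> A * \<theta> ^ n + B"
      and n: "n \<le> L"
    have g0: "norm (g 0) \<le> A" using start deg by simp
    have "norm (g (Suc j) - z * g j) \<le> 2 * K * A * \<theta> ^ j + K * B" if j: "j < L" for j
    proof -
      obtain L' where L': "L = Suc L'" using j by (cases L) auto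
      have "norm (g (Suc j) - z * g j) \<le> K * (2 * A * \<theta> ^ j + B)"
      proof (rule K(2)[of "2 * A" B L' "\<lambda>n. g (Suc n) - z * g n"])
        fix i assume i: "i < degree r" "i \<le> L'"
        have "norm (z * g i) \<le> 1 * A"
          unfolding norm_mult using start i deg L' zb \<rho> by (intro mult_mono) auto
        moreover have "norm (g (Suc i)) \<le> A" using start i deg L' by simp
        ultimately show "norm (g (Suc i) - z * g i) \<le> 2 * A"
          using norm_triangle_ineq4[of "g (Suc i)" "z * g i"] by linarith
      next
        fix i assume "i + degree r \<le> L'"
        then have "norm (shift_poly q g i) \<le> A * \<theta> ^ i + B" using rec deg L' by simp
        also have "A * \<theta> ^ i \<le> 2 * A * \<theta> ^ i" using A \<rho> by (intro mult_right_mono) auto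
        finally show "norm (shift_poly r (\<lambda>n. g (Suc n) - z * g n) i) \<le> 2 * A * \<theta> ^ i + B"
          unfolding r shift_poly_linear_factor by simp
      qed (use A B L' j in auto)
      then show ?thesis by (simp add: algebra_simps)
    qed
    from first_order_recurrence_decay[OF zb \<rho>(2,3) _ _ this n]
    have "norm (g n) \<le> (norm (g 0) + 2 * K * A / (\<theta> - \<rho>)) * \<theta> ^ n + K * B / (1 - \<rho>)"
      using A B K(1) by simp
    also have "\<dots> \<le> (A + 2 * K * A / (\<theta> - \<rho>)) * \<theta> ^ n + K * B / (1 - \<rho>)"
      using g0 \<rho> by (intro add_right_mono mult_right_mono) auto
    also have "\<dots> = (1 + 2 * K / (\<theta> - \<rho>)) * (A * \<theta> ^ n) + K / (1 - \<rho>) * B"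
      by (simp add: algebra_simps)
    also have "\<dots> \<le> K' * (A * \<theta> ^ n) + K' * B"
      using parts A B \<rho> by (intro add_mono mult_right_mono) (auto simp: K'_def)
    finally show "norm (g n) \<le> K' * (A * \<theta> ^ n + B)" by (simp add: algebra_simps)
  qed
qed

lemma coeff_ab_poly: "coeff (ab_poly M) k = (if k < M then of_real (ab_beta M (M - k)) else 0)"
proof -
  have "coeff (ab_poly M) k = (\<Sum>m=1..M. if m = M - k then (if k < M then of_real (ab_beta M m) else 0) else 0)"
    unfolding ab_poly_def coeff_sum coeff_monom by (intro sum.cong) auto
  also have "\<dots> = (if k < M then of_real (ab_beta M (M - k)) else 0)" by (auto simp: sum.delta)
  finally show ?thesis .
qed

lemma degree_ab_poly:
  assumes "M \<ge> 1"
  shows "degree (ab_poly M) = M - 1"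
proof (rule antisym)
  show "degree (ab_poly M) \<le> M - 1" by (rule degree_le) (auto simp: coeff_ab_poly)
  show "M - 1 \<le> degree (ab_poly M)"
    using assms ab_beta_1_pos[OF assms] by (intro le_degree) (auto simp: coeff_ab_poly)
qed

lemma ab_poly_nonzero: "M \<ge> 1 \<Longrightarrow> ab_poly M \<noteq> 0"
  using coeff_ab_poly[of M "M - 1"] ab_beta_1_pos[of M] by auto

lemma rho_ab_bounds:
  assumes "M \<ge> 2"
  shows "poly (ab_poly M) z = 0 \<Longrightarrow> norm z \<le> rho_ab M" and "0 \<le> rho_ab M"
proof -
  have "{norm z | z. poly (ab_poly M) z = 0} = norm ` {z. poly (ab_poly M) z = 0}" by auto
  then have fin: "finite {norm z | z. poly (ab_poly M) z = 0}"
    using poly_roots_finite[OF ab_poly_nonzero, of M] assms by simp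
  show *: "norm z \<le> rho_ab M" if "poly (ab_poly M) z = 0" for z
    unfolding rho_ab_def by (rule Max_ge[OF fin]) (use that in auto)
  obtain z where "poly (ab_poly M) z = 0"
    using fundamental_theorem_of_algebra[of "ab_poly M"] degree_ab_poly[of M] assms
    by (auto simp: constant_degree)
  from *[OF this] show "0 \<le> rho_ab M" using norm_ge_zero order_trans by blast
qed

lemma ab_recurrence_decay:
  assumes M: "M \<ge> 2" and \<theta>: "rho_ab M < \<theta>" "\<theta> < 1"
  shows "\<exists>K\<ge>0. \<forall>e L A B. 0 \<le> A \<longrightarrow> 0 \<le> B \<longrightarrow> (\<forall>j<M - 1. \<bar>e j\<bar> \<le> A) \<longrightarrow>
    (\<forall>n. M \<le> n \<longrightarrow> n \<le> Suc L \<longrightarrow> \<bar>\<Sum>m=1..M. ab_beta M m * e (n - m)\<bar> \<le> B) \<longrightarrow>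
    (\<forall>n\<le>L. \<bar>e n\<bar> \<le> K * (A * \<theta> ^ n + B))"
proof -
  have M1: "M \<ge> 1" using M by simp
  note \<rho> = rho_ab_bounds[OF M]
  have shift: "shift_poly (ab_poly M) (\<lambda>n. of_real (e n)) n =
      of_real (\<Sum>m=1..M. ab_beta M m * e (n + M - m))" for e n
  proof -
    have "shift_poly (ab_poly M) (\<lambda>n. of_real (e n)) n =
        (\<Sum>k\<le>M - 1. of_real (ab_beta M (M - k) * e (n + k)))"
      unfolding shift_poly_def degree_ab_poly[OF M1]
      using M by (intro sum.cong refl) (auto simp: coeff_ab_poly)
    also have "\<dots> = (\<Sum>m=1..M. of_real (ab_beta M m * e (n + M - m)))"
      by (rule sum.reindex_bij_witness[of _ "\<lambda>m. M - m" "\<lambda>k. M - k"]) (use M in auto)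
    finally show ?thesis by simp
  qed
  obtain K where K: "K \<ge> 0" "\<And>g L A B n. 0 \<le> A \<Longrightarrow> 0 \<le> B \<Longrightarrow>
    (\<And>j. j < M - 1 \<Longrightarrow> norm (g j) \<le> A) \<Longrightarrow>
    (\<And>n. n + (M - 1) \<le> L \<Longrightarrow> norm (shift_poly (ab_poly M) g n) \<le> A * \<theta> ^ n + B) \<Longrightarrow>
    n \<le> L \<Longrightarrow> norm (g n) \<le> K * (A * \<theta> ^ n + B)"
    using recurrence_decay[OF \<rho>(2) \<theta> ab_poly_nonzero[OF M1] \<rho>(1)] degree_ab_poly[OF M1] by metis
  show ?thesis
  proof (intro exI[of _ K] conjI allI impI K(1))
    fix e :: "nat \<Rightarrow> real" and L n and A B :: real
    assume A: "0 \<le> A" and B: "0 \<le> B" and start: "\<forall>j<M - 1. \<bar>e j\<bar> \<le> A"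
      and rec: "\<forall>n. M \<le> n \<longrightarrow> n \<le> Suc L \<longrightarrow> \<bar>\<Sum>m=1..M. ab_beta M m * e (n - m)\<bar> \<le> B"
      and n: "n \<le> L"
    have "norm (of_real (e n) :: complex) \<le> K * (A * \<theta> ^ n + B)"
    proof (rule K(2)[OF A B _ _ n])
      fix k assume "k + (M - 1) \<le> L"
      then have "norm (shift_poly (ab_poly M) (\<lambda>n. of_real (e n)) k) \<le> B"
        unfolding shift norm_of_real using rec M by simp
      moreover have "0 \<le> A * \<theta> ^ k" using A \<rho>(2) \<theta> by simp
      ultimately show "norm (shift_poly (ab_poly M) (\<lambda>n. of_real (e n)) k) \<le> A * \<theta> ^ k + B" by simp
    qed (use start in simp)
    then show "\<bar>e n\<bar> \<le> K * (A * \<theta> ^ n + B)" by simp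
  qed
qed

section \<open>From grid values to the integral\<close>

text \<open>Split the lag into \<open>L\<close> unit lags; each of them gives a telescoping sum. Applied to the running integral of
  \<open>\<bar>w\<bar>\<close>, it expresses that overlapping windows of \<open>L\<close> cells count every cell at most \<open>L\<close> times.\<close>

lemma sum_lagged_differences_le:
  fixes f :: "nat \<Rightarrow> real"
  assumes "\<And>k. 0 \<le> f k" "\<And>k. f k \<le> R"
  shows "(\<Sum>k=K..<N. f (k + L) - f k) \<le> real L * R"
proof (induction L)
  case (Suc L)
  have "(\<Sum>k=K..<N. f (k + Suc L) - f (k + L)) \<le> R"
  proof (cases "K \<le> N")
    case True
    have "(\<Sum>k=K..<N. f (Suc k + L) - f (k + L)) = f (N + L) - f (K + L)"
      by (rule sum_Suc_diff'[OF True, of "\<lambda>k. f (k + L)"])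
    then show ?thesis using assms(1)[of "K + L"] assms(2)[of "N + L"] by simp
  next
    case False
    then show ?thesis using assms(1)[of 0] assms(2)[of 0] by simp
  qed
  moreover have "(\<Sum>k=K..<N. f (k + Suc L) - f k) =
      (\<Sum>k=K..<N. f (k + L) - f k) + (\<Sum>k=K..<N. f (k + Suc L) - f (k + L))"
    by (simp flip: sum.distrib)
  ultimately show ?case using Suc by (simp add: algebra_simps)
qed simp

lemma integral_le_open_interval_bound:
  fixes f :: "real \<Rightarrow> real"
  assumes "a \<le> b" "f integrable_on {a..b}" "\<And>t. a < t \<Longrightarrow> t < b \<Longrightarrow> f t \<le> c"
  shows "integral {a..b} f \<le> (b - a) * c"
proof -
  have "integral {a<..<b} f \<le> integral {a<..<b} (\<lambda>_. c)"
    using assms by (intro integral_le) (auto simp: integrable_on_open_interval_real)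
  then show ?thesis using assms(1) by (simp flip: integral_open_interval_real)
qed

text \<open>The value at \<open>t\<close> minus the extrapolation from the \<open>M\<close> grid points at and before \<open>t\<^sub>k\<close> is a functional of
  the kind treated in \<open>weak_deriv_functional_bound\<close>. Only points to the left are used since nothing is
  known about the value at the final time \<open>t\<^sub>N\<close>, where the scheme never evaluates the right-hand side.\<close>

lemma pointwise_bound_from_grid:
  fixes g w :: "real \<Rightarrow> real"
  defines "v \<equiv> \<lambda>u. LINT s:{0<..<u}|lebesgue. \<bar>w s\<bar>"
  assumes weak: "has_weak_deriv M 0 T g w" and cont: "continuous_on {0..T} g"
    and M: "M \<ge> 1" and h: "h > 0" and k: "M \<le> k" and t: "real k * h \<le> t" "t \<le> real (k + 1) * h" "t < T"
    and G: "\<And>m. m \<in> {1..M} \<Longrightarrow> \<bar>g (real (k + 1 - m) * h)\<bar> \<le> G"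
  shows "\<bar>g t\<bar> \<le> real M * real M ^ M * G + (1 + real M * real M ^ M) * (real (M + 1) * h) ^ (M - 1) *
    (v (min (real (k + 2) * h) T) - v (real (k - M) * h))"
proof -
  obtain p where p: "M = Suc p" using M by (cases M) auto
  define \<sigma> where "\<sigma> = (t - real k * h) / h"
  have \<sigma>: "0 \<le> \<sigma>" "\<sigma> \<le> 1" "t = real k * h + \<sigma> * h" using h t by (auto simp: \<sigma>_def field_simps)
  define c where "c i = (if i = 0 then 1 else - poly (backward_lagrange M i) \<sigma>)" for i
  define s where "s i = (if i = 0 then t else real (k + 1 - i) * h)" for i
  \<comment> \<open>All points used have to be interior to \<open>[a, b]\<close>, and \<open>[a, b]\<close> interior to \<open>(0, T)\<close>. So \<open>a\<close> lies half a cell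
    before the first node, and \<open>b\<close> halfway between \<open>t\<close> and the nearer of \<open>t + h\<close> and \<open>T\<close>.\<close>
  define a where "a = (real (k - M) + 1/2) * h"
  define b where "b = (t + min T (t + h)) / 2"
  have node: "real (k + 1 - m) * h = real k * h + (1 - real m) * h" if "m \<in> {1..M}" for m
    using that k by (simp add: of_nat_diff algebra_simps)
  have split0: "(\<Sum>i\<in>{0..M}. F i) = F 0 + (\<Sum>m=1..M. F m)" for F :: "nat \<Rightarrow> real"
    by (simp add: sum.atLeast_Suc_atMost)
  have functional: "(\<Sum>i\<in>{0..M}. c i * H (s i)) =
      H t - (\<Sum>m=1..M. poly (backward_lagrange M m) \<sigma> * H (real (k + 1 - m) * h))" for H
  proof -
    have "(\<Sum>m=1..M. c m * H (s m)) =
        (\<Sum>m=1..M. - (poly (backward_lagrange M m) \<sigma> * H (real (k + 1 - m) * h)))"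
      by (intro sum.cong refl) (auto simp: c_def s_def)
    then show ?thesis unfolding split0 by (simp add: c_def s_def sum_negf)
  qed
  have at: "a < t"
  proof -
    have "real (k - M) + 1/2 < real k" using k M by (simp add: of_nat_diff)
    then have "a < real k * h" unfolding a_def using h by (intro mult_strict_right_mono) auto
    then show ?thesis using t by linarith
  qed
  have b: "t < b" "b < T" "b \<le> t + h / 2" using t h by (auto simp: b_def min_def field_simps)
  have a: "0 < a" using h by (simp add: a_def)
  have w_int: "set_integrable lebesgue {0<..<T} w" using weak by (simp add: has_weak_deriv_def)
  have "\<bar>\<Sum>i\<in>{0..M}. c i * g (s i)\<bar>
      \<le> (b - a) ^ p * (\<Sum>i\<in>{0..M}. \<bar>c i\<bar>) * (LINT t:{a..b}|lebesgue. \<bar>w t\<bar>)"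
  proof (rule weak_deriv_functional_bound[where T = T and g = g and s = s and c = c and w = w])
    show "has_weak_deriv (Suc p) 0 T g w" using weak p by simp
    show "continuous_on {a..b} g" by (rule continuous_on_subset[OF cont]) (use a b in auto)
    show "a < s i \<and> s i < b" if "i \<in> {0..M}" for i
    proof (cases "i = 0")
      case True
      then show ?thesis using at b by (simp add: s_def)
    next
      case False
      then have i: "i \<in> {1..M}" using that by auto
      have "real (k - M) + 1/2 < real (k + 1 - i)" using i k by (simp add: of_nat_diff)
      then have "a < real (k + 1 - i) * h" unfolding a_def using h by (intro mult_strict_right_mono) auto
      moreover have "real (k + 1 - i) * h \<le> real k * h" using i h by (intro mult_right_mono) auto
      ultimately have "a < real (k + 1 - i) * h \<and> real (k + 1 - i) * h < b" using t b by linarith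
      then show ?thesis using False by (simp add: s_def)
    qed
    show "(\<Sum>i\<in>{0..M}. c i * s i ^ j) = 0" if "j \<le> p" for j
    proof -
      define Q where "Q = [:real k * h, h:] ^ j"
      have "degree Q \<le> j" unfolding Q_def using degree_power_le[of "[:real k * h, h:]" j] h by simp
      then have "poly Q \<sigma> = (\<Sum>m=1..M. poly (backward_lagrange M m) \<sigma> * poly Q (1 - real m))"
        using that p by (intro backward_lagrange_interpolation) simp
      moreover have "poly Q \<sigma> = t ^ j" by (simp add: Q_def poly_power \<sigma>(3) mult.commute)
      moreover have "poly Q (1 - real m) = (real (k + 1 - m) * h) ^ j" if "m \<in> {1..M}" for m
        unfolding node[OF that] by (simp add: Q_def poly_power mult.commute)
      ultimately show ?thesis using functional[of "\<lambda>r. r ^ j"] by simp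
    qed
  qed (use a at b in auto)
  also have "(b - a) ^ p * (\<Sum>i\<in>{0..M}. \<bar>c i\<bar>) * (LINT t:{a..b}|lebesgue. \<bar>w t\<bar>)
      \<le> (real (M + 1) * h) ^ p * (1 + real M * real M ^ M) *
      (v (min (real (k + 2) * h) T) - v (real (k - M) * h))"
  proof (intro mult_mono power_mono)
    have "b \<le> (real (k + 1) + 1/2) * h" using b(3) t(2) by (simp add: algebra_simps)
    also have "\<dots> = a + real (M + 1) * h" using k by (simp add: a_def of_nat_diff algebra_simps)
    finally show "b - a \<le> real (M + 1) * h" by simp
    have "(\<Sum>m=1..M. \<bar>c m\<bar>) \<le> (\<Sum>m=1..M. real M ^ M)"
      by (intro sum_mono) (use backward_lagrange_bound \<sigma> in \<open>auto simp: c_def\<close>)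
    then show "(\<Sum>i\<in>{0..M}. \<bar>c i\<bar>) \<le> 1 + real M * real M ^ M"
      unfolding split0 by (simp add: c_def)
    define u1 where "u1 = real (k - M) * h"
    define u2 where "u2 = min (real (k + 2) * h) T"
    have u: "0 \<le> u1" "u1 < a" "b < u2" "u2 \<le> T"
    proof -
      show "0 \<le> u1" "u1 < a" using h by (auto simp: u1_def a_def)
      have "b < real (k + 2) * h" using b(3) t(2) h by (simp add: algebra_simps)
      then show "b < u2" "u2 \<le> T" using b by (auto simp: u2_def)
    qed
    have int: "integrable lebesgue (\<lambda>s. indicator X s * \<bar>w s\<bar>)"
      if "X \<in> sets lebesgue" "X \<subseteq> {0<..<T}" for X
      using set_integrable_abs[OF set_integrable_subset[OF w_int that]]
      by (simp add: set_integrable_def)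
    have "(LINT s|lebesgue. indicator {0<..<u1} s * \<bar>w s\<bar> + indicator {a..b} s * \<bar>w s\<bar>)
        \<le> (LINT s|lebesgue. indicator {0<..<u2} s * \<bar>w s\<bar>)"
      using u a b at by (intro integral_mono Bochner_Integration.integrable_add int)
        (auto simp: indicator_def)
    moreover have "(LINT s|lebesgue. indicator {0<..<u1} s * \<bar>w s\<bar> + indicator {a..b} s * \<bar>w s\<bar>) =
        v u1 + (LINT s:{a..b}|lebesgue. \<bar>w s\<bar>)"
      unfolding v_def set_lebesgue_integral_def real_scaleR_def
      using u a b at by (intro Bochner_Integration.integral_add int) auto
    ultimately show "(LINT s:{a..b}|lebesgue. \<bar>w s\<bar>)
        \<le> v (min (real (k + 2) * h) T) - v (real (k - M) * h)"
      unfolding u1_def u2_def v_def set_lebesgue_integral_def real_scaleR_def by linarith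
    show "0 \<le> (LINT s:{a..b}|lebesgue. \<bar>w s\<bar>)"
      by (simp add: set_lebesgue_integral_def)
  qed (use a at b h in \<open>auto intro!: sum_nonneg mult_nonneg_nonneg\<close>)
  finally have main: "\<bar>\<Sum>i\<in>{0..M}. c i * g (s i)\<bar> \<le> (1 + real M * real M ^ M) * (real (M + 1) * h) ^ (M - 1) *
      (v (min (real (k + 2) * h) T) - v (real (k - M) * h))"
    by (simp add: p mult_ac)
  note functional[of g]
  moreover have "\<bar>\<Sum>m=1..M. poly (backward_lagrange M m) \<sigma> * g (real (k + 1 - m) * h)\<bar>
      \<le> (\<Sum>m=1..M. real M ^ M * G)"
    by (rule order_trans[OF sum_abs sum_mono])
       (auto simp only: abs_mult intro!: mult_mono backward_lagrange_bound G \<sigma> zero_le_power of_nat_0_le_iff)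
  ultimately show ?thesis using main by simp
qed

text \<open>Integrate the pointwise bound over every cell. The window of the cell \<open>[t\<^sub>k, t\<^sub>k\<^sub>+\<^sub>1]\<close> reaches from
  \<open>t\<^sub>k\<^sub>-\<^sub>M\<close> to \<open>t\<^sub>k\<^sub>+\<^sub>2\<close>, which is the source of the factor \<open>M + 2\<close>.\<close>

lemma integral_bound_from_grid:
  fixes g w :: "real \<Rightarrow> real"
  assumes weak: "has_weak_deriv M 0 T g w" and cont: "continuous_on {0..T} g"
    and M: "M \<ge> 1" and T: "T > 0" and N: "N \<ge> 1" and h: "h = T / real N" and K: "M \<le> K" "K \<le> N"
    and G: "\<And>j. K + 1 - M \<le> j \<Longrightarrow> j < N \<Longrightarrow> \<bar>g (real j * h)\<bar> \<le> G" "0 \<le> G"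
  shows "integral {real K * h..T} (\<lambda>t. \<bar>g t\<bar>) \<le> real M * real M ^ M * T * G +
    (1 + real M * real M ^ M) * real (M + 1) ^ (M - 1) * real (M + 2) * h ^ M *
    (LINT s:{0<..<T}|lebesgue. \<bar>w s\<bar>)"
proof -
  define v where "v u = (LINT s:{0<..<u}|lebesgue. \<bar>w s\<bar>)" for u
  define f where "f k = v (min ((real k - real M) * h) T)" for k :: nat
  define c1 where "c1 = real M * real M ^ M"
  define c2 where "c2 = (1 + c1) * real (M + 1) ^ (M - 1)"
  have hpos: "h > 0" and Nh: "real N * h = T" using T N h by auto
  have c: "0 \<le> c1" "0 \<le> c2" by (auto simp: c1_def c2_def)
  have w_int: "set_integrable lebesgue {0<..<T} (\<lambda>s. \<bar>w s\<bar>)"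
    using weak by (auto simp: has_weak_deriv_def intro: set_integrable_abs)
  have f0: "0 \<le> f k" for k unfolding f_def v_def by (simp add: set_lebesgue_integral_def)
  have fR: "f k \<le> v T" for k
  proof -
    have "(LINT s|lebesgue. indicator {0<..<min ((real k - real M) * h) T} s * \<bar>w s\<bar>)
        \<le> (LINT s|lebesgue. indicator {0<..<T} s * \<bar>w s\<bar>)"
      using w_int by (intro Bochner_Integration.integral_mono') (auto simp: set_integrable_def indicator_def)
    then show ?thesis unfolding f_def v_def set_lebesgue_integral_def by simp
  qed
  have int: "(\<lambda>t. \<bar>g t\<bar>) integrable_on {x..y}" if "0 \<le> x" "y \<le> T" for x y
    by (intro integrable_continuous_real continuous_intros continuous_on_subset[OF cont]) (use that in auto)
  have gridT: "real k * h \<le> T" if "k \<le> N" for k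
    using mult_right_mono[of "real k" "real N" h] that hpos Nh by simp
  have block: "integral {real k * h..real (Suc k) * h} (\<lambda>t. \<bar>g t\<bar>)
      \<le> h * (c1 * G + c2 * h ^ (M - 1) * (f (k + (M + 2)) - f k))" if k: "K \<le> k" "k < N" for k
  proof -
    have "integral {real k * h..real (Suc k) * h} (\<lambda>t. \<bar>g t\<bar>)
        \<le> (real (Suc k) * h - real k * h) * (c1 * G + c2 * h ^ (M - 1) * (f (k + (M + 2)) - f k))"
    proof (rule integral_le_open_interval_bound)
      fix t assume t: "real k * h < t" "t < real (Suc k) * h"
      have "\<bar>g t\<bar> \<le> c1 * G + (1 + c1) * (real (M + 1) * h) ^ (M - 1) *
          (v (min (real (k + 2) * h) T) - v (real (k - M) * h))"
        unfolding c1_def v_def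
      proof (rule pointwise_bound_from_grid[OF weak cont M hpos])
        show "t < T" using t gridT[of "Suc k"] k by simp
        show "\<bar>g (real (k + 1 - m) * h)\<bar> \<le> G" if "m \<in> {1..M}" for m
          using that k K by (intro G) auto
      qed (use t k K in auto)
      also have "real (k + 2) * h = (real (k + (M + 2)) - real M) * h" by simp
      also have "v (real (k - M) * h) = f k"
        using k K gridT[of "k - M"] by (simp add: f_def of_nat_diff)
      finally show "\<bar>g t\<bar> \<le> c1 * G + c2 * h ^ (M - 1) * (f (k + (M + 2)) - f k)"
        unfolding f_def c2_def by (simp add: power_mult_distrib mult_ac)
    qed (use hpos gridT[of "Suc k"] k in \<open>auto intro!: int\<close>)
    then show ?thesis by (simp add: algebra_simps)
  qed
  have "integral {real K * h..real n * h} (\<lambda>t. \<bar>g t\<bar>) =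
      (\<Sum>k=K..<n. integral {real k * h..real (Suc k) * h} (\<lambda>t. \<bar>g t\<bar>))" if "K \<le> n" "n \<le> N" for n
    using that
  proof (induction n rule: dec_induct)
    case (step n)
    have "integral {real K * h..real n * h} (\<lambda>t. \<bar>g t\<bar>) + integral {real n * h..real (Suc n) * h} (\<lambda>t. \<bar>g t\<bar>)
        = integral {real K * h..real (Suc n) * h} (\<lambda>t. \<bar>g t\<bar>)"
      by (rule Henstock_Kurzweil_Integration.integral_combine)
         (use step hpos gridT[of "Suc n"] in \<open>auto intro!: int mult_right_mono\<close>)
    then show ?case using step by simp
  qed simp
  from this[of N] have "integral {real K * h..T} (\<lambda>t. \<bar>g t\<bar>) =
      (\<Sum>k=K..<N. integral {real k * h..real (Suc k) * h} (\<lambda>t. \<bar>g t\<bar>))" using K Nh by simp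
  also have "\<dots> \<le> (\<Sum>k=K..<N. h * (c1 * G + c2 * h ^ (M - 1) * (f (k + (M + 2)) - f k)))"
    by (intro sum_mono block) auto
  also have "\<dots> = c1 * G * (real (N - K) * h) + c2 * (h * h ^ (M - 1)) * (\<Sum>k=K..<N. f (k + (M + 2)) - f k)"
    unfolding distrib_left sum.distrib by (simp add: sum_distrib_left mult_ac)
  also have "\<dots> \<le> c1 * G * T + c2 * (h * h ^ (M - 1)) * (real (M + 2) * v T)"
    using c hpos G(2) gridT[of "N - K"]
    by (intro add_mono mult_left_mono sum_lagged_differences_le f0 fR) auto
  also have "h * h ^ (M - 1) = h ^ M" using M by (simp add: power_eq_if)
  finally show ?thesis by (simp add: c1_def c2_def v_def mult_ac)
qed

section \<open>Convergence of zero-residual solutions\<close>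

text \<open>With \<open>y = - a N ln \<theta>\<close> the expression is a constant times \<open>y\<^sup>M / e\<^sup>y\<close>.\<close>

lemma exponential_decay_beats_power:
  fixes \<theta> a b A :: real
  assumes "0 < \<theta>" "\<theta> < 1" "0 < a"
  shows "\<forall>\<^sub>F N in sequentially. A * \<theta> powr (a * real N - b) * real N ^ M \<le> 1"
proof -
  define l where "l = - ln \<theta> * a"
  have l: "l > 0" using assms mult_pos_pos[of "- ln \<theta>" a] by (simp add: l_def)
  have "LIM N sequentially. l * real N :> at_top"
    using l by (intro filterlim_tendsto_pos_mult_at_top[OF tendsto_const _ filterlim_real_sequentially])
  from filterlim_compose[OF tendsto_power_div_exp_0[of M] this]
  have "(\<lambda>N. A * \<theta> powr (- b) / l ^ M * ((l * real N) ^ M / exp (l * real N))) \<longlonglongrightarrow>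
      A * \<theta> powr (- b) / l ^ M * 0"
    by (intro tendsto_intros)
  moreover have "A * \<theta> powr (- b) / l ^ M * ((l * real N) ^ M / exp (l * real N)) =
      A * \<theta> powr (a * real N - b) * real N ^ M" for N
  proof -
    have "\<theta> powr (a * real N - b) = \<theta> powr (- b) * \<theta> powr (a * real N)"
      by (simp flip: powr_add)
    also have "\<theta> powr (a * real N) = inverse (exp (l * real N))"
      using assms by (simp add: powr_def l_def mult_ac flip: exp_minus)
    finally show ?thesis using l by (simp add: power_mult_distrib field_simps)
  qed
  ultimately have "(\<lambda>N. A * \<theta> powr (a * real N - b) * real N ^ M) \<longlonglongrightarrow> 0" by simp
  from order_tendstoD(2)[OF this, of 1] show ?thesis by (auto elim: eventually_mono)
qed

lemma zero_ab_loss_residual: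
  assumes M: "M \<ge> 1" and N: "M \<le> N" and loss: "ab_loss M T x i N u = 0" and n: "M \<le> n" "n \<le> N"
  shows "(\<Sum>m=1..M. ab_beta M m * u (x (grid T N (n - m)))) =
    (x (grid T N n) $ i - x (grid T N (n - 1)) $ i) / (T / real N)"
proof -
  have "real N - real M + 1 \<noteq> 0" using N by simp
  then have "(\<Sum>n=M..N. \<bar>(\<Sum>m=1..M. ab_beta M m * u (x (grid T N (n - m))))
        - inverse (T / real N) * (\<Sum>m=0..M. ab_alpha m * (x (grid T N (n - m)) $ i))\<bar> ^ 2) = 0"
    using loss unfolding ab_loss_def by simp
  then have "(\<Sum>m=1..M. ab_beta M m * u (x (grid T N (n - m)))) =
      inverse (T / real N) * (\<Sum>m=0..M. ab_alpha m * (x (grid T N (n - m)) $ i))"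
    using n by (subst (asm) sum_nonneg_eq_0_iff) auto
  also have "(\<Sum>m=0..M. ab_alpha m * (x (grid T N (n - m)) $ i)) =
      (\<Sum>m\<in>{0, 1}. ab_alpha m * (x (grid T N (n - m)) $ i))"
    using M by (intro sum.mono_neutral_right) (auto simp: ab_alpha_def)
  also have "\<dots> = x (grid T N n) $ i - x (grid T N (n - 1)) $ i"
    by (simp add: ab_alpha_def)
  finally show ?thesis by (simp add: divide_inverse mult.commute)
qed

text \<open>Scalar form of the data: \<open>y j\<close> is the \<open>j\<close>-th derivative of the chosen component of the solution. The
  right-hand side along the trajectory thus inherits all derivatives that the truncation estimate needs.\<close>

lemma Ck_solution_component:
  fixes x :: "real \<Rightarrow> real ^ 'd"
  assumes T: "T > 0" and ode: "\<forall>t\<in>{0..T}. (x has_vector_derivative F (x t)) (at t within {0..T})"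
    and Ck: "Ck_on_interval (Suc M) 0 T x" and M: "M \<ge> 1"
  obtains y B where "\<And>j t. t \<in> {0..T} \<Longrightarrow> j \<le> M \<Longrightarrow>
      (y j has_real_derivative y (Suc j) t) (at t within {0..T})"
    "\<And>t. t \<in> {0..T} \<Longrightarrow> y 0 t = x t $ i" "\<And>t. t \<in> {0..T} \<Longrightarrow> y 1 t = F (x t) $ i"
    "\<And>t. t \<in> {0..T} \<Longrightarrow> \<bar>y (Suc M) t\<bar> \<le> B" "0 \<le> B"
proof -
  from Ck obtain D where "\<forall>t\<in>{0..T}. D 0 t = x t"
    "\<forall>j<Suc M. \<forall>t\<in>{0..T}. (D j has_vector_derivative D (Suc j) t) (at t within {0..T})"
    and D3: "continuous_on {0..T} (D (Suc M))"
    unfolding Ck_on_interval_def by blast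
  then have D: "\<And>t. t \<in> {0..T} \<Longrightarrow> D 0 t = x t"
    "\<And>j t. j \<le> M \<Longrightarrow> t \<in> {0..T} \<Longrightarrow> (D j has_vector_derivative D (Suc j) t) (at t within {0..T})"
    by (simp_all add: less_Suc_eq_le)
  have D1: "D 1 t = F (x t)" if t: "t \<in> {0..T}" for t
  proof -
    have "(D 0 has_vector_derivative F (x t)) (at t within {0..T})"
      by (rule has_vector_derivative_transform[OF t _ ode[rule_format, OF t]]) (use D(1) in auto)
    moreover have "(D 0 has_vector_derivative D 1 t) (at t within {0..T})"
      using D(2)[OF _ t, of 0] by simp
    ultimately show ?thesis
      using vector_derivative_unique_within_closed_interval[OF T, of t "D 0"] t by simp
  qed
  have "continuous_on {0..T} (\<lambda>t. D (Suc M) t $ i)" by (intro continuous_intros D3)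
  then have "compact ((\<lambda>t. D (Suc M) t $ i) ` {0..T})" by (intro compact_continuous_image) auto
  then obtain B where B: "0 < B" "\<forall>r\<in>(\<lambda>t. D (Suc M) t $ i) ` {0..T}. norm r \<le> B"
    using compact_imp_bounded bounded_pos by blast
  show thesis
  proof (rule that[of "\<lambda>j t. D j t $ i" B])
    fix j t assume "t \<in> {0..T}" "j \<le> M"
    from bounded_linear.has_vector_derivative[OF bounded_linear_vec_nth D(2)[OF this(2,1)]]
    show "((\<lambda>t. D j t $ i) has_real_derivative D (Suc j) t $ i) (at t within {0..T})"
      by (simp add: has_real_derivative_iff_has_vector_derivative)
  qed (use D D1 B in auto)
qed

theorem theorem4p4:
  fixes M p :: nat
  assumes "M \<ge> 2" and "p = M" and "rho_ab M < 1"
  shows "\<exists>C\<^sub>M :: real \<Rightarrow> real.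
    \<forall>(T::real) (x :: real \<Rightarrow> real ^ 'd) (x_init :: real ^ 'd) (F :: real ^ 'd \<Rightarrow> real ^ 'd)
      (i :: 'd) (\<Omega> :: (real ^ 'd) set) (A :: (real ^ 'd \<Rightarrow> real) set).
      0 < T \<and>
      (\<forall>t\<in>{0..T}. (x has_vector_derivative F (x t)) (at t within {0..T})) \<and>
      x 0 = x_init \<and>
      Ck_on_interval (p + 1) 0 T x \<and>
      (\<exists>U. open U \<and> x ` {0..T} \<subseteq> U \<and> U \<subseteq> \<Omega>) \<and>
      (\<forall>v\<in>A. continuous_on \<Omega> v)
    \<longrightarrow> (\<exists>C::real. \<forall>(R::real) (u :: nat \<Rightarrow> real ^ 'd \<Rightarrow> real).
      0 < R \<and>
      (\<forall>N\<ge>M. u N \<in> trace_class p T x (\<lambda>y. F y $ i) A R \<and> ab_loss M T x i N (u N) = 0) \<and>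
      Bseq (\<lambda>N. boundary_error M T x (\<lambda>y. F y $ i) N (u N))
    \<longrightarrow> (\<forall>\<delta> \<theta>. 0 < \<delta> \<and> \<delta> < T \<and> rho_ab M < \<theta> \<and> \<theta> < 1 \<longrightarrow>
      (\<exists>h_hat>0. \<forall>N\<ge>M. T / real N < h_hat \<longrightarrow>
        (LINT t:{\<delta>..T}|lebesgue. \<bar>u N (x t) - F (x t) $ i\<bar>)
          \<le> C\<^sub>M \<theta> * (C + R) * (T / real N) ^ p)))"
proof -
  have M: "M \<ge> 2" "M \<ge> 1" and p: "p = M" using assms by auto
  have "\<forall>\<theta>. \<exists>K. rho_ab M < \<theta> \<and> \<theta> < 1 \<longrightarrow> K \<ge> 0 \<and> (\<forall>e L A B. 0 \<le> A \<longrightarrow> 0 \<le> B \<longrightarrow>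
    (\<forall>j<M - 1. \<bar>e j\<bar> \<le> A) \<longrightarrow>
    (\<forall>n. M \<le> n \<longrightarrow> n \<le> Suc L \<longrightarrow> \<bar>\<Sum>m=1..M. ab_beta M m * e (n - m)\<bar> \<le> B) \<longrightarrow>
    (\<forall>n\<le>L. \<bar>e n\<bar> \<le> K * (A * \<theta> ^ n + B)))"
    using ab_recurrence_decay[OF M(1)] by blast
  from choice[OF this] obtain K where K: "\<forall>\<theta>. rho_ab M < \<theta> \<and> \<theta> < 1 \<longrightarrow>
    K \<theta> \<ge> 0 \<and> (\<forall>e L A B. 0 \<le> A \<longrightarrow> 0 \<le> B \<longrightarrow>
    (\<forall>j<M - 1. \<bar>e j\<bar> \<le> A) \<longrightarrow>
    (\<forall>n. M \<le> n \<longrightarrow> n \<le> Suc L \<longrightarrow> \<bar>\<Sum>m=1..M. ab_beta M m * e (n - m)\<bar> \<le> B) \<longrightarrow>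
    (\<forall>n\<le>L. \<bar>e n\<bar> \<le> K \<theta> * (A * \<theta> ^ n + B)))" ..
  define c1 where "c1 = real M * real M ^ M"
  define c2 where "c2 = (1 + c1) * real (M + 1) ^ (M - 1) * real (M + 2)"
  have c: "0 \<le> c1" "0 \<le> c2" by (auto simp: c1_def c2_def)
  show ?thesis
  \<comment> \<open>The part \<open>c1 * K \<theta>\<close> stems from the grid values and \<open>c2\<close> from the oscillation between them.\<close>
  proof (rule exI[of _ "\<lambda>\<theta>. c1 * K \<theta> + c2"], intro allI impI, elim conjE exE)
    fix T :: real and x :: "real \<Rightarrow> real ^ 'd" and x_init :: "real ^ 'd"
      and F :: "real ^ 'd \<Rightarrow> real ^ 'd" and i :: 'd and \<Omega> U :: "(real ^ 'd) set"
      and A :: "(real ^ 'd \<Rightarrow> real) set"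
    assume T: "0 < T"
      and ode: "\<forall>t\<in>{0..T}. (x has_vector_derivative F (x t)) (at t within {0..T})"
      and Ck: "Ck_on_interval (p + 1) 0 T x"
      and U: "x ` {0..T} \<subseteq> U" "U \<subseteq> \<Omega>" and A: "\<forall>v\<in>A. continuous_on \<Omega> v"
    obtain y B where y: "\<And>j t. t \<in> {0..T} \<Longrightarrow> j \<le> M \<Longrightarrow>
        (y j has_real_derivative y (Suc j) t) (at t within {0..T})"
      "\<And>t. t \<in> {0..T} \<Longrightarrow> y 0 t = x t $ i" "\<And>t. t \<in> {0..T} \<Longrightarrow> y 1 t = F (x t) $ i"
      "\<And>t. t \<in> {0..T} \<Longrightarrow> \<bar>y (Suc M) t\<bar> \<le> B" "0 \<le> B"
      using Ck_solution_component[OF T ode _ M(2)] Ck p by (metis Suc_eq_plus1)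
    define \<tau> where "\<tau> = (1 + real M ^ M * (\<Sum>m=1..M. \<bar>ab_beta M m\<bar>)) * B"
    have \<tau>: "0 \<le> \<tau>" using y(5) by (auto simp: \<tau>_def intro!: mult_nonneg_nonneg add_nonneg_nonneg sum_nonneg)
    show "\<exists>C::real. \<forall>(R::real) (u :: nat \<Rightarrow> real ^ 'd \<Rightarrow> real).
      0 < R \<and>
      (\<forall>N\<ge>M. u N \<in> trace_class p T x (\<lambda>y. F y $ i) A R \<and> ab_loss M T x i N (u N) = 0) \<and>
      Bseq (\<lambda>N. boundary_error M T x (\<lambda>y. F y $ i) N (u N))
    \<longrightarrow> (\<forall>\<delta> \<theta>. 0 < \<delta> \<and> \<delta> < T \<and> rho_ab M < \<theta> \<and> \<theta> < 1 \<longrightarrow>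
      (\<exists>h_hat>0. \<forall>N\<ge>M. T / real N < h_hat \<longrightarrow>
        (LINT t:{\<delta>..T}|lebesgue. \<bar>u N (x t) - F (x t) $ i\<bar>)
          \<le> (c1 * K \<theta> + c2) * (C + R) * (T / real N) ^ p))"
    \<comment> \<open>The truncation error contributes \<open>T * \<tau>\<close>; the starting values, which are damped to at most \<open>h\<^sup>M\<close> at time
      \<open>\<delta>\<close> once \<open>h\<close> is small, contribute \<open>1\<close>.\<close>
    proof (rule exI[of _ "1 + T * \<tau>"], intro allI impI, elim conjE)
      fix R :: real and u :: "nat \<Rightarrow> real ^ 'd \<Rightarrow> real" and \<delta> \<theta> :: real
      assume R: "0 < R"
        and u: "\<forall>N\<ge>M. u N \<in> trace_class p T x (\<lambda>y. F y $ i) A R \<and> ab_loss M T x i N (u N) = 0"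
        and Bs: "Bseq (\<lambda>N. boundary_error M T x (\<lambda>y. F y $ i) N (u N))"
        and \<delta>: "0 < \<delta>" "\<delta> < T" and \<theta>: "rho_ab M < \<theta>" "\<theta> < 1"
      have K\<theta>: "0 \<le> K \<theta>" and recurrence: "\<forall>e L A B. 0 \<le> A \<longrightarrow> 0 \<le> B \<longrightarrow>
          (\<forall>j<M - 1. \<bar>e j\<bar> \<le> A) \<longrightarrow>
          (\<forall>n. M \<le> n \<longrightarrow> n \<le> Suc L \<longrightarrow> \<bar>\<Sum>m=1..M. ab_beta M m * e (n - m)\<bar> \<le> B) \<longrightarrow>
          (\<forall>n\<le>L. \<bar>e n\<bar> \<le> K \<theta> * (A * \<theta> ^ n + B))"
        using K \<theta> by blast+
      have \<theta>0: "0 < \<theta>" using rho_ab_bounds(2)[OF M(1)] \<theta> by linarith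
      obtain E where E: "0 < E" "\<And>N. \<bar>boundary_error M T x (\<lambda>y. F y $ i) N (u N)\<bar> \<le> E"
        using Bs unfolding Bseq_def by auto
      have "\<forall>\<^sub>F N in sequentially. T * E / T ^ M * \<theta> powr (\<delta> / T * real N - real M) * real N ^ M \<le> 1"
        by (rule exponential_decay_beats_power) (use \<theta>0 \<theta> \<delta> T in auto)
      moreover have "\<forall>\<^sub>F N in sequentially. real M + 1 \<le> \<delta> / T * real N"
      proof -
        have "LIM N sequentially. \<delta> / T * real N :> at_top"
          using \<delta> T by (intro filterlim_tendsto_pos_mult_at_top[OF tendsto_const _ filterlim_real_sequentially]) simp
        then show ?thesis by (simp add: filterlim_at_top)
      qed
      ultimately have "\<forall>\<^sub>F N in sequentially.
          T * E / T ^ M * \<theta> powr (\<delta> / T * real N - real M) * real N ^ M \<le> 1 \<and> real M + 1 \<le> \<delta> / T * real N"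
        by (rule eventually_conj)
      then obtain N0 where N0: "\<And>N. N \<ge> N0 \<Longrightarrow>
          T * E / T ^ M * \<theta> powr (\<delta> / T * real N - real M) * real N ^ M \<le> 1 \<and> real M + 1 \<le> \<delta> / T * real N"
        unfolding eventually_sequentially by blast
      show "\<exists>h_hat>0. \<forall>N\<ge>M. T / real N < h_hat \<longrightarrow>
        (LINT t:{\<delta>..T}|lebesgue. \<bar>u N (x t) - F (x t) $ i\<bar>)
          \<le> (c1 * K \<theta> + c2) * (1 + T * \<tau> + R) * (T / real N) ^ p"
      proof (intro exI[of _ "T / real (Suc N0)"] conjI allI impI)
        show "0 < T / real (Suc N0)" using T by simp
        fix N assume N: "M \<le> N" and small: "T / real N < T / real (Suc N0)"
        define h where "h = T / real N"
        have N1: "N \<ge> 1" using N M by simp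
        have h: "h > 0" and Nh: "real N * h = T" using T N1 by (auto simp: h_def)
        have "N \<ge> N0"
        proof (rule ccontr)
          assume "\<not> N0 \<le> N"
          then have "T / real (Suc N0) \<le> T / real N" using T N1 by (intro divide_left_mono) auto
          then show False using small by simp
        qed
        note large = N0[OF this]
        define g where "g = (\<lambda>t. u N (x t) - F (x t) $ i)"
        have uN: "u N \<in> A" "g \<in> sobolev_W1 M 0 T" "sobolev_W1_seminorm M 0 T g \<le> R"
          "ab_loss M T x i N (u N) = 0"
          using u[rule_format, OF N] unfolding trace_class_def g_def p mem_Collect_eq by blast+
        have mem: "real n * h \<in> {0..T}" if "n \<le> N" for n
          using mult_right_mono[of "real n" "real N" h] that h Nh by auto
        have cont: "continuous_on {0..T} g"
        proof -
          have "continuous_on {0..T} x"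
            using ode by (intro continuous_on_vector_derivative) auto
          moreover have "continuous_on \<Omega> (u N)" using A uN(1) by blast
          ultimately have "continuous_on {0..T} (\<lambda>t. u N (x t))"
            using U by (intro continuous_on_compose2[of \<Omega> "u N" "{0..T}" x]) auto
          moreover have "continuous_on {0..T} (y 1)"
            using y(1)[of _ 1] M by (intro DERIV_continuous_on) auto
          then have "continuous_on {0..T} (\<lambda>t. F (x t) $ i)"
            using continuous_on_cong[of "{0..T}" "{0..T}" "y 1"] y(3) by simp
          ultimately show ?thesis unfolding g_def by (rule continuous_on_diff)
        qed
        define w where "w = weak_deriv M 0 T g"
        have weak: "has_weak_deriv M 0 T g w"
        proof -
          have "\<exists>w. has_weak_deriv M 0 T g w" using uN(2) unfolding sobolev_W1_def by blast
          then show ?thesis unfolding w_def weak_deriv_def by (rule someI_ex)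
        qed
        have wR: "(LINT s:{0<..<T}|lebesgue. \<bar>w s\<bar>) \<le> R"
          using uN(3) unfolding sobolev_W1_seminorm_def w_def .
        have grid: "\<bar>g (real n * h)\<bar> \<le> K \<theta> * (E * \<theta> ^ n + \<tau> * h ^ M)" if n: "n \<le> N - 1" for n
        proof (rule recurrence[rule_format, OF _ _ _ _ n, where e = "\<lambda>n. g (real n * h)"])
          show "0 \<le> \<tau> * h ^ M" using \<tau> h by simp
          fix j assume "j < M - 1"
          then have "\<bar>g (real j * h)\<bar> \<le> (\<Sum>j=0..M - 2. \<bar>g (real j * h)\<bar>)"
            by (intro member_le_sum) auto
          also have "\<dots> = boundary_error M T x (\<lambda>y. F y $ i) N (u N)"
            by (simp add: boundary_error_def g_def grid_def h_def)
          also have "\<dots> \<le> E" using E(2)[of N] by linarith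
          finally show "\<bar>g (real j * h)\<bar> \<le> E" .
        next
          fix n assume n: "M \<le> n" "n \<le> Suc (N - 1)"
          then have nN: "n \<le> N" using N1 by simp
          have le: "real n * h \<le> T" using mem[OF nN] by simp
          have sol: "(y 0 (real n * h) - y 0 (real (n - 1) * h)) / h =
              (\<Sum>m=1..M. ab_beta M m * u N (x (real (n - m) * h)))"
            using zero_ab_loss_residual[OF M(2) N uN(4) n(1) nN]
              y(2)[OF mem[OF nN]] y(2)[OF mem[of "n - 1"]] nN
            by (simp add: grid_def h_def)
          have "(\<Sum>m=1..M. ab_beta M m * g (real (n - m) * h)) =
              (\<Sum>m=1..M. ab_beta M m * u N (x (real (n - m) * h))) -
              (\<Sum>m=1..M. ab_beta M m * y 1 (real (n - m) * h))"
            unfolding sum_subtractf[symmetric] using y(3)[OF mem] nN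
            by (intro sum.cong refl) (simp add: g_def right_diff_distrib)
          then show "\<bar>\<Sum>m=1..M. ab_beta M m * g (real (n - m) * h)\<bar> \<le> \<tau> * h ^ M"
            using ab_truncation_error[OF M(2) h n(1) le y(1,4)] sol
            unfolding \<tau>_def by linarith
        qed (use E in simp)
        \<comment> \<open>The cell of \<open>\<delta>\<close> starts at \<open>t\<^sub>k\<close>. Extrapolation to it uses grid values from \<open>t\<^sub>k\<^sub>+\<^sub>1\<^sub>-\<^sub>M\<close> on.\<close>
        define k where "k = nat \<lfloor>\<delta> / T * real N\<rfloor>"
        have k: "real k \<le> \<delta> / T * real N" "\<delta> / T * real N < real k + 1"
          using large by (auto simp: k_def of_nat_nat)
        have kh: "real k * h \<le> \<delta>"
          using mult_right_mono[OF k(1), of h] h T N1 by (simp add: h_def)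
        have kM: "M \<le> k" using large k(2) by linarith
        have kN: "k \<le> N"
        proof -
          have "real k * h \<le> real N * h" using kh \<delta> Nh by simp
          then show ?thesis using h by simp
        qed
        define G where "G = K \<theta> * (E * \<theta> ^ (k + 1 - M) + \<tau> * h ^ M)"
        have G: "\<bar>g (real j * h)\<bar> \<le> G" if "k + 1 - M \<le> j" "j < N" for j
        proof -
          have "\<theta> ^ j \<le> \<theta> ^ (k + 1 - M)" using that \<theta> \<theta>0 by (intro power_decreasing) auto
          then have "K \<theta> * (E * \<theta> ^ j + \<tau> * h ^ M) \<le> G"
            unfolding G_def using K\<theta> E by (intro mult_left_mono add_right_mono) auto
          moreover have "j \<le> N - 1" using that by simp
          ultimately show ?thesis using grid order_trans by blast
        qed
        have G0: "0 \<le> G" unfolding G_def using K\<theta> E \<tau> h \<theta>0 by simp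
        have decay: "T * E * \<theta> ^ (k + 1 - M) \<le> h ^ M"
        proof -
          have "\<theta> ^ (k + 1 - M) = \<theta> powr real (k + 1 - M)" using \<theta>0 by (simp add: powr_realpow)
          also have "\<dots> \<le> \<theta> powr (\<delta> / T * real N - real M)"
            using k kM \<theta> \<theta>0 by (intro powr_mono') (auto simp: of_nat_diff)
          finally have "T * E * \<theta> ^ (k + 1 - M) \<le> T * E * \<theta> powr (\<delta> / T * real N - real M)"
            using T E by (intro mult_left_mono) auto
          also have "\<dots> \<le> h ^ M"
            using large T N1 by (simp add: h_def power_divide field_simps)
          finally show ?thesis .
        qed
        have "(LINT t:{\<delta>..T}|lebesgue. \<bar>g t\<bar>) = integral {\<delta>..T} (\<lambda>t. \<bar>g t\<bar>)"
          by (intro set_lebesgue_integral_eq_integral absolutely_integrable_continuous_real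
              continuous_intros continuous_on_subset[OF cont]) (use \<delta> in auto)
        also have "\<dots> \<le> integral {real k * h..T} (\<lambda>t. \<bar>g t\<bar>)"
          using kh \<delta> h by (intro integral_subset_le integrable_continuous_real continuous_intros
              continuous_on_subset[OF cont]) auto
        also have "\<dots> \<le> c1 * T * G + c2 * h ^ M * (LINT s:{0<..<T}|lebesgue. \<bar>w s\<bar>)"
          unfolding c1_def c2_def
          by (rule integral_bound_from_grid[OF weak cont M(2) T N1 h_def kM kN G G0])
        also have "\<dots> \<le> c1 * T * G + c2 * h ^ M * R"
          using wR c h by (intro add_left_mono mult_left_mono) auto
        also have "c1 * T * G = c1 * K \<theta> * (T * E * \<theta> ^ (k + 1 - M) + T * \<tau> * h ^ M)"
          by (simp add: G_def algebra_simps)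
        also have "\<dots> \<le> c1 * K \<theta> * (h ^ M + T * \<tau> * h ^ M)"
          using decay c K\<theta> by (intro mult_left_mono add_right_mono) auto
        also have "c1 * K \<theta> * (h ^ M + T * \<tau> * h ^ M) + c2 * h ^ M * R
            \<le> c1 * K \<theta> * (h ^ M + T * \<tau> * h ^ M) + c2 * h ^ M * R
              + (c1 * K \<theta> * (R * h ^ M) + c2 * ((1 + T * \<tau>) * h ^ M))"
          using c K\<theta> R T \<tau> h by (simp add: mult_nonneg_nonneg add_nonneg_nonneg)
        also have "\<dots> = (c1 * K \<theta> + c2) * (1 + T * \<tau> + R) * h ^ M"
          by (simp add: algebra_simps)
        finally show "(LINT t:{\<delta>..T}|lebesgue. \<bar>u N (x t) - F (x t) $ i\<bar>)
            \<le> (c1 * K \<theta> + c2) * (1 + T * \<tau> + R) * (T / real N) ^ p"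
          by (simp add: g_def h_def p)
      qed
    qed
  qed
qed

end
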